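(* For a solution of the truncated CMC hierarchy with additional Killing fields $\mathbf P_\pm$, let $$\mathcal S:=\frac{1}{32\gamma}\lambda^{-2}\,[\mathbf Y,\dot{\mathbf Y}]-\frac1{8\gamma}\,[\mathbf P_+,\dot{\mathbf P}_+]+\frac1{8\gamma}\lambda^{-2}\,[\mathbf P_-,\dot{\mathbf P}_-].$$ Then $\mathcal S$ is a spectral Killing field, i.e. it is $\boldsymbol{\mathfrak g}$-valued and satisfies the inhomogeneous Killing field equation $$d\mathcal S+[\phi,\mathcal S]=\dot\phi .$$
   Context: Conventions. $N\ge 0$ is a fixed integer; $\gamma$ is a fixed nonzero constant with $\bar\gamma=\gamma$ and a fixed root $\sqrt\gamma$; $\mathrm i=\sqrt{-1}$; $\lambda$ is a formal parameter. A dot denotes the Euler operator, $\dot A=\lambda\,\partial A/\partial\lambda$. The bar is complex conjugation extended by $\bar\lambda=\lambda^{-1}$, and $\bar A^t$ is the conjugate transpose. For a matrix 1-form $\phi$ and matrix function $A$, $[\phi,A]=\phi A-A\phi$. $\boldsymbol{\mathfrak g}$ is the twisted loop algebra of formal Laurent series (finitely many negative powers) in $\mathfrak{sl}(2,\mathbb C)((\lambda))$ whose diagonal entries are even and whose off-diagonal entries are odd in $\lambda$; $\boldsymbol{\mathfrak g}_{\ge k}$, $\boldsymbol{\mathfrak g}_{\le k}$ consist of those containing only powers $\ge k$, $\le k$. Functions with values in such spaces are series whose coefficients are functions on $M$. Truncated CMC hierarchy. A solution consists of a simply connected manifold $M$ with functions $t_0,\dots,t_N$, their conjugates $\bar t_m$,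 a real 1-form $\rho$ (with $dt_m,d\bar t_m,\rho$ a coframe), a nowhere zero function $h_2$ with a fixed root $h_2^{1/2}$, and functions $a^{2n+1},b^{2n+2},c^{2n+2}$, $n\ge0$ (superscripts are indices), with $b^2=-\mathrm i\gamma h_2^{-1/2}$, $c^2=\mathrm i h_2^{1/2}$. Put $\mathbf a=\sum_{n\ge0}\lambda^{2n}a^{2n+1}$, $\mathbf b=\sum_{n\ge0}\lambda^{2n+1}b^{2n+2}$, $\mathbf c=\sum_{n\ge0}\lambda^{2n+1}c^{2n+2}$, $$\mathbf Y=\begin{pmatrix}-\mathrm i\mathbf a&2\mathbf c\\2\mathbf b&\mathrm i\mathbf a\end{pmatrix},\qquad \det\mathbf Y=\mathbf a^2-4\mathbf b\mathbf c=-4\gamma\lambda^2 .$$ For $m\ge0$ write $\frac1{2\mathrm i}\lambda^{-(2m+2)}\mathbf Y=U_m+U_{(m+1)}$ with $U_m\in\boldsymbol{\mathfrak g}_{\le-1}$, $U_{(m+1)}\in\boldsymbol{\mathfrak g}_{\ge0}$, and put $$\phi=-\sum_{m=0}^N\bar U_m^t\,d\bar t_m+\phi_0+\sum_{m=0}^NU_m\,dt_m,$$ where $\phi_0$ is the diagonal matrix with entries $\frac{\mathrm i}{2}\rho,-\frac{\mathrm i}{2}\rho$. The structure equations are $d\mathbf Y+[\phi,\mathbf Y]=0$ and $d\phi+\phi\wedge\phi=0$, together with their conjugates. Dressed objects. $\mathfrak t=\frac1{2\mathrm i}\sum_{m=0}^N\lambda^{-(2m+2)}t_m$, $\alpha=d\mathfrak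 t$, and $\check\phi=\phi-\mathbf Y\alpha$ (with entries $\check\phi^i_j$), which is $\boldsymbol{\mathfrak g}_{\ge0}$-valued. Fix a root $\sqrt{\mathbf b\mathbf c}$ (note $\mathbf b\mathbf c=\gamma\lambda^2+\cdots$), put $\kappa=\frac{1}{2\sqrt{\mathbf b\mathbf c}}$, and let $\mathbf p$ be a $\mathbb C[[\lambda^2]]$-valued function with $d\mathbf p=\sqrt\gamma\,(\mathbf b\check\phi^1_2+\mathbf c\check\phi^2_1)/(\mathbf b\mathbf c)$ (a closed 1-form). Set $$\mathbf V_+=\kappa\begin{pmatrix}2\sinh(\lambda\mathbf p)\lambda^{-1}\mathbf b\mathbf c&2\sqrt\gamma\cosh(\lambda\mathbf p)\mathbf c+\mathrm i\sinh(\lambda\mathbf p)\lambda^{-1}\mathbf a\mathbf c\\-2\sqrt\gamma\cosh(\lambda\mathbf p)\mathbf b+\mathrm i\sinh(\lambda\mathbf p)\lambda^{-1}\mathbf a\mathbf b&-2\sinh(\lambda\mathbf p)\lambda^{-1}\mathbf b\mathbf c\end{pmatrix},$$ $$\mathbf V_-=\kappa\begin{pmatrix}-2\cosh(\lambda\mathbf p)\mathbf b\mathbf c&-2\sqrt\gamma\sinh(\lambda\mathbf p)\lambda\mathbf c-\mathrm i\cosh(\lambda\mathbf p)\mathbf a\mathbf c\\2\sqrt\gamma\sinh(\lambda\mathbf p)\lambda\mathbf b-\mathrm i\cosh(\lambda\mathbf p)\mathbf a\mathbf b&2\cosh(\lambda\mathbf p)\mathbf b\mathbf c\end{pmatrix},$$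 and $$\mathbf P_+=\cosh(4\sqrt\gamma\lambda\mathfrak t)\mathbf V_+-\lambda^{-1}\sinh(4\sqrt\gamma\lambda\mathfrak t)\mathbf V_-,\qquad \mathbf P_-=-\lambda\sinh(4\sqrt\gamma\lambda\mathfrak t)\mathbf V_++\cosh(4\sqrt\gamma\lambda\mathfrak t)\mathbf V_- .$$ Here $\cosh,\sinh$ of $4\sqrt\gamma\lambda\mathfrak t$ are treated formally, as combinations of formal invertible symbols $E^{\pm1}=\exp(\pm4\sqrt\gamma\lambda\mathfrak t)$ with $dE^{\pm1}=\pm4\sqrt\gamma\lambda\alpha E^{\pm1}$ and $\dot E^{\pm1}=\pm4\sqrt\gamma(\lambda\mathfrak t)^{\boldsymbol\cdot}E^{\pm1}$, where $(\lambda\mathfrak t)^{\boldsymbol\cdot}=\lambda(\mathfrak t+\dot{\mathfrak t})$. *)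

theory Defs
  imports
    "HOL-Analysis.Analysis"
    "HOL-Computational_Algebra.Formal_Laurent_Series"
    "HOL-Library.Poly_Mapping"
begin

section \<open>Smooth manifolds, tangent vectors and one-forms\<close>

text \<open>For open \<open>S\<close> in a Euclidean space, \<open>Ck_on k S f\<close> says that \<open>f\<close> is of class \<open>C\<^sup>k\<close> on \<open>S\<close>.\<close>

fun Ck_on :: "nat \<Rightarrow> 'a::real_normed_vector set \<Rightarrow> ('a \<Rightarrow> 'b::real_normed_vector) \<Rightarrow> bool" where
  "Ck_on 0 S f \<longleftrightarrow> continuous_on S f"
| "Ck_on (Suc k) S f \<longleftrightarrow>
     f differentiable_on S \<and> (\<forall>v. Ck_on k S (\<lambda>x. frechet_derivative f (at x) v))"

definition smooth_on :: "'a::real_normed_vector set \<Rightarrow> ('a \<Rightarrow> 'b::real_normed_vector) \<Rightarrow> bool" where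
  "smooth_on S f \<longleftrightarrow> (\<forall>k. Ck_on k S f)"

text \<open>
  The manifold is a whole type \<open>'m\<close>, Hausdorff and second countable by its type class, with an
  atlas of charts \<open>(U, \<psi>)\<close> into a Euclidean space \<open>'e\<close>; \<open>\<psi>\<close> matters only on \<open>U\<close>, and the atlas
  need not be maximal.
\<close>

type_synonym ('m, 'e) atlas = "('m set \<times> ('m \<Rightarrow> 'e)) set"

definition smooth_atlas ::
  "('m::{t2_space, second_countable_topology}, 'e::euclidean_space) atlas \<Rightarrow> bool" where
  "smooth_atlas \<A> \<longleftrightarrow>
     (\<forall>(U, \<psi>) \<in> \<A>. open U \<and> open (\<psi> ` U) \<and> (\<exists>\<psi>'. homeomorphism U (\<psi> ` U) \<psi> \<psi>')) \<and>
     \<Union> (fst ` \<A>) = UNIV \<and>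
     (\<forall>(U, \<psi>) \<in> \<A>. \<forall>(V, \<eta>) \<in> \<A>. smooth_on (\<psi> ` (U \<inter> V)) (\<eta> \<circ> inv_into U \<psi>))"

definition smooth_fun ::
  "('m, 'e::euclidean_space) atlas \<Rightarrow> ('m \<Rightarrow> 'b::real_normed_vector) \<Rightarrow> bool" where
  "smooth_fun \<A> f \<longleftrightarrow> (\<forall>(U, \<psi>) \<in> \<A>. smooth_on (\<psi> ` U) (f \<circ> inv_into U \<psi>))"

type_synonym 'm tvec = "('m \<Rightarrow> real) \<Rightarrow> real"

text \<open>
  Tangent vectors at \<open>q\<close> are the derivations at \<open>q\<close> of the algebra of smooth real functions.
  They are set to 0 on non-smooth functions, so that the tangent space has the right dimension.
\<close>

definition tangent_space :: "('m, 'e::euclidean_space) atlas \<Rightarrow> 'm \<Rightarrow> 'm tvec set" where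
  "tangent_space \<A> q = {v.
     (\<forall>f g a b. smooth_fun \<A> f \<longrightarrow> smooth_fun \<A> g \<longrightarrow>
        v (\<lambda>x. a * f x + b * g x) = a * v f + b * v g) \<and>
     (\<forall>f g. smooth_fun \<A> f \<longrightarrow> smooth_fun \<A> g \<longrightarrow>
        v (\<lambda>x. f x * g x) = f q * v g + g q * v f) \<and>
     (\<forall>f. \<not> smooth_fun \<A> f \<longrightarrow> v f = 0)}"

definition vector_field :: "('m, 'e::euclidean_space) atlas \<Rightarrow> ('m \<Rightarrow> 'm tvec) \<Rightarrow> bool" where
  "vector_field \<A> X \<longleftrightarrow> (\<forall>q. X q \<in> tangent_space \<A> q) \<and>
     (\<forall>f. smooth_fun \<A> f \<longrightarrow> smooth_fun \<A> (\<lambda>q. X q f))"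

definition lie_bracket :: "('m \<Rightarrow> 'm tvec) \<Rightarrow> ('m \<Rightarrow> 'm tvec) \<Rightarrow> 'm \<Rightarrow> 'm tvec" where
  "lie_bracket X Y q f = X q (\<lambda>x. Y x f) - Y q (\<lambda>x. X x f)"

definition covector ::
  "('m, 'e::euclidean_space) atlas \<Rightarrow> 'm \<Rightarrow> ('m tvec \<Rightarrow> 'b::real_vector) \<Rightarrow> bool" where
  "covector \<A> q l \<longleftrightarrow> (\<forall>v \<in> tangent_space \<A> q. \<forall>w \<in> tangent_space \<A> q. \<forall>a b.
     l (\<lambda>f. a * v f + b * w f) = a *\<^sub>R l v + b *\<^sub>R l w)"

definition one_form ::
  "('m, 'e::euclidean_space) atlas \<Rightarrow> ('m \<Rightarrow> 'm tvec \<Rightarrow> 'b::real_normed_vector) \<Rightarrow> bool" where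
  "one_form \<A> \<omega> \<longleftrightarrow> (\<forall>q. covector \<A> q (\<omega> q)) \<and>
     (\<forall>X. vector_field \<A> X \<longrightarrow> smooth_fun \<A> (\<lambda>q. \<omega> q (X q)))"

definition dC :: "'m tvec \<Rightarrow> ('m \<Rightarrow> complex) \<Rightarrow> complex" where
  "dC v f = Complex (v (\<lambda>q. Re (f q))) (v (\<lambda>q. Im (f q)))"

section \<open>Formal series in the spectral parameter\<close>

type_synonym lmat = "complex fls^2^2"

abbreviation lam :: "complex fls" where "lam \<equiv> fls_X"
abbreviation lam_inv :: "complex fls" where "lam_inv \<equiv> fls_X_inv"
abbreviation cst :: "complex \<Rightarrow> complex fls" where "cst \<equiv> fls_const"

definition mat22 :: "'a \<Rightarrow> 'a \<Rightarrow> 'a \<Rightarrow> 'a \<Rightarrow> 'a::zero^2^2" where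
  "mat22 x y z w = vector [vector [x, y], vector [z, w]]"

definition msc :: "'a::times \<Rightarrow> 'a^2^2 \<Rightarrow> 'a^2^2" where
  "msc x A = map_matrix ((*) x) A"

definition comm :: "'a::ring_1^2^2 \<Rightarrow> 'a^2^2 \<Rightarrow> 'a^2^2" where
  "comm A B = A ** B - B ** A"

definition euler :: "complex fls \<Rightarrow> complex fls" where
  "euler f = lam * fls_deriv f"

text \<open>
  Conjugation with \<open>\<lambda> \<mapsto> \<lambda>\<^sup>-\<^sup>1\<close>. It is meaningful for Laurent polynomials only, and is
  applied below only to principal parts of Laurent series.
\<close>

definition fls_bar :: "complex fls \<Rightarrow> complex fls" where
  "fls_bar f = Abs_fls (\<lambda>n. cnj (fls_nth f (- n)))"

definition bar_transpose :: "lmat \<Rightarrow> lmat" where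
  "bar_transpose A = transpose (map_matrix fls_bar A)"

definition twisted_loop_algebra :: "lmat set" where
  "twisted_loop_algebra = {A. trace A = 0 \<and>
     (\<forall>i j n. fls_nth (A $ i $ j) n \<noteq> 0 \<longrightarrow> (even n \<longleftrightarrow> i = j))}"

text \<open>
  A function on \<open>M\<close> with values in Laurent series is a Laurent series whose coefficients are
  smooth functions on \<open>M\<close>; hence the bound on the negative powers is uniform on \<open>M\<close>.
\<close>

definition smooth_fls ::
  "('m, 'e::euclidean_space) atlas \<Rightarrow> ('m \<Rightarrow> complex fls) \<Rightarrow> bool" where
  "smooth_fls \<A> F \<longleftrightarrow> (\<forall>n. smooth_fun \<A> (\<lambda>q. fls_nth (F q) n)) \<and>
     (\<exists>k. \<forall>q. \<forall>n<k. fls_nth (F q) n = 0)"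

definition g_valued :: "('m, 'e::euclidean_space) atlas \<Rightarrow> ('m \<Rightarrow> lmat) \<Rightarrow> bool" where
  "g_valued \<A> F \<longleftrightarrow> (\<forall>q. F q \<in> twisted_loop_algebra) \<and>
     (\<forall>i j. smooth_fls \<A> (\<lambda>q. F q $ i $ j))"

definition dfls :: "'m tvec \<Rightarrow> ('m \<Rightarrow> complex fls) \<Rightarrow> complex fls" where
  "dfls v F = Abs_fls (\<lambda>n. dC v (\<lambda>q. fls_nth (F q) n))"

definition dmat :: "'m tvec \<Rightarrow> ('m \<Rightarrow> lmat) \<Rightarrow> lmat" where
  "dmat v F = (\<chi> i j. dfls v (\<lambda>q. F q $ i $ j))"

text \<open>\<open>flat \<A> \<phi>\<close> is \<open>d\<phi> + \<phi> \<and> \<phi> = 0\<close>, evaluated on pairs of vector fields.\<close>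

definition flat :: "('m, 'e::euclidean_space) atlas \<Rightarrow> ('m \<Rightarrow> 'm tvec \<Rightarrow> lmat) \<Rightarrow> bool" where
  "flat \<A> \<phi> \<longleftrightarrow> (\<forall>X Y q. vector_field \<A> X \<longrightarrow> vector_field \<A> Y \<longrightarrow>
     dmat (X q) (\<lambda>x. \<phi> x (Y x)) - dmat (Y q) (\<lambda>x. \<phi> x (X x)) - \<phi> q (lie_bracket X Y q)
       + comm (\<phi> q (X q)) (\<phi> q (Y q)) = 0)"

section \<open>The truncated CMC hierarchy\<close>

text \<open>
  The fields \<open>acoef\<close>, \<open>bcoef\<close>, \<open>ccoef\<close> are indexed by the superscripts: \<open>acoef S (2*n+1)\<close> is
  \<open>a\<^sup>2\<^sup>n\<^sup>+\<^sup>1\<close>, \<open>bcoef S (2*n+2)\<close> is \<open>b\<^sup>2\<^sup>n\<^sup>+\<^sup>2\<close>; the other indices are unused.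
\<close>

record 'm cmc_data =
  tfun :: "nat \<Rightarrow> 'm \<Rightarrow> complex"
  rho :: "'m \<Rightarrow> 'm tvec \<Rightarrow> real"
  h2 :: "'m \<Rightarrow> complex"
  h2_root :: "'m \<Rightarrow> complex"
  acoef :: "nat \<Rightarrow> 'm \<Rightarrow> complex"
  bcoef :: "nat \<Rightarrow> 'm \<Rightarrow> complex"
  ccoef :: "nat \<Rightarrow> 'm \<Rightarrow> complex"

definition bold_a :: "'m cmc_data \<Rightarrow> 'm \<Rightarrow> complex fls" where
  "bold_a S q = fps_to_fls (Abs_fps (\<lambda>k. if even k then acoef S (k + 1) q else 0))"

definition bold_b :: "'m cmc_data \<Rightarrow> 'm \<Rightarrow> complex fls" where
  "bold_b S q = fps_to_fls (Abs_fps (\<lambda>k. if odd k then bcoef S (k + 1) q else 0))"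

definition bold_c :: "'m cmc_data \<Rightarrow> 'm \<Rightarrow> complex fls" where
  "bold_c S q = fps_to_fls (Abs_fps (\<lambda>k. if odd k then ccoef S (k + 1) q else 0))"

definition Ymat :: "'m cmc_data \<Rightarrow> 'm \<Rightarrow> lmat" where
  "Ymat S q = mat22 (- cst \<i> * bold_a S q) (2 * bold_c S q)
                    (2 * bold_b S q) (cst \<i> * bold_a S q)"

definition Umat :: "'m cmc_data \<Rightarrow> nat \<Rightarrow> 'm \<Rightarrow> lmat" where
  "Umat S m q =
     map_matrix fls_prpart_as_fls (msc (cst (1 / (2 * \<i>)) * lam_inv ^ (2 * m + 2)) (Ymat S q))"

definition dt :: "'m cmc_data \<Rightarrow> nat \<Rightarrow> 'm tvec \<Rightarrow> complex" where
  "dt S m v = dC v (tfun S m)"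

definition dtbar :: "'m cmc_data \<Rightarrow> nat \<Rightarrow> 'm tvec \<Rightarrow> complex" where
  "dtbar S m v = dC v (\<lambda>q. cnj (tfun S m q))"

definition phi :: "nat \<Rightarrow> 'm cmc_data \<Rightarrow> 'm \<Rightarrow> 'm tvec \<Rightarrow> lmat" where
  "phi N S q v =
     - (\<Sum>m\<le>N. msc (cst (dtbar S m v)) (bar_transpose (Umat S m q)))
     + mat22 (cst (\<i> / 2 * of_real (rho S q v))) 0 0 (cst (- \<i> / 2 * of_real (rho S q v)))
     + (\<Sum>m\<le>N. msc (cst (dt S m v)) (Umat S m q))"

text \<open>
  \<open>(dt\<^sub>m, dtbar\<^sub>m, \<rho>)\<close>, \<open>m \<le> N\<close>, is at every point a basis of the complexified cotangent space;
  this forces \<open>dim M = 2N + 3\<close>.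
\<close>

definition coframe :: "('m, 'e::euclidean_space) atlas \<Rightarrow> nat \<Rightarrow> 'm cmc_data \<Rightarrow> bool" where
  "coframe \<A> N S \<longleftrightarrow> (\<forall>q.
     (\<forall>l :: 'm tvec \<Rightarrow> complex. covector \<A> q l \<longrightarrow>
        (\<exists>x y z. \<forall>v \<in> tangent_space \<A> q.
           l v = (\<Sum>m\<le>N. x m * dt S m v) + (\<Sum>m\<le>N. y m * dtbar S m v)
                 + z * of_real (rho S q v))) \<and>
     (\<forall>x y z. (\<forall>v \<in> tangent_space \<A> q.
           (\<Sum>m\<le>N. x m * dt S m v) + (\<Sum>m\<le>N. y m * dtbar S m v)
                 + z * of_real (rho S q v) = 0) \<longrightarrow>
        (\<forall>m\<le>N. x m = 0 \<and> y m = 0) \<and> z = 0))"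

text \<open>
  The conjugates of the structure equations are not listed: \<open>M\<close> is a real manifold, so
  conjugation commutes with \<open>d\<close>, and they follow by applying it to both sides.
\<close>

definition truncated_cmc_solution ::
  "('m::{t2_space, second_countable_topology}, 'e::euclidean_space) atlas \<Rightarrow>
   nat \<Rightarrow> complex \<Rightarrow> 'm cmc_data \<Rightarrow> bool" where
  "truncated_cmc_solution \<A> N \<gamma> S \<longleftrightarrow>
     smooth_atlas \<A> \<and> simply_connected (UNIV :: 'm set) \<and>
     (\<forall>m\<le>N. smooth_fun \<A> (tfun S m)) \<and> one_form \<A> (rho S) \<and> coframe \<A> N S \<and>
     smooth_fun \<A> (h2 S) \<and> (\<forall>q. h2 S q \<noteq> 0) \<and>
     smooth_fun \<A> (h2_root S) \<and> (\<forall>q. (h2_root S q)\<^sup>2 = h2 S q) \<and>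
     (\<forall>n. smooth_fun \<A> (acoef S (2 * n + 1)) \<and> smooth_fun \<A> (bcoef S (2 * n + 2)) \<and>
          smooth_fun \<A> (ccoef S (2 * n + 2))) \<and>
     (\<forall>q. bcoef S 2 q = - \<i> * \<gamma> / h2_root S q) \<and>
     (\<forall>q. ccoef S 2 q = \<i> * h2_root S q) \<and>
     (\<forall>q. det (Ymat S q) = cst (- 4 * \<gamma>) * lam\<^sup>2) \<and>
     (\<forall>q. \<forall>v \<in> tangent_space \<A> q. dmat v (Ymat S) + comm (phi N S q v) (Ymat S q) = 0) \<and>
     flat \<A> (phi N S)"

section \<open>Dressed objects\<close>

definition tfrak :: "nat \<Rightarrow> 'm cmc_data \<Rightarrow> 'm \<Rightarrow> complex fls" where
  "tfrak N S q = cst (1 / (2 * \<i>)) * (\<Sum>m\<le>N. lam_inv ^ (2 * m + 2) * cst (tfun S m q))"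

definition alpha :: "nat \<Rightarrow> 'm cmc_data \<Rightarrow> 'm tvec \<Rightarrow> complex fls" where
  "alpha N S v = dfls v (tfrak N S)"

definition phi_check :: "nat \<Rightarrow> 'm cmc_data \<Rightarrow> 'm \<Rightarrow> 'm tvec \<Rightarrow> lmat" where
  "phi_check N S q v = phi N S q v - msc (alpha N S v) (Ymat S q)"

definition cosh_lam :: "complex fps \<Rightarrow> complex fls" where
  "cosh_lam p = fps_to_fls
     (fps_compose (fps_const (1/2) * (fps_exp 1 + fps_exp (- 1))) (fps_X * p))"

definition sinh_lam :: "complex fps \<Rightarrow> complex fls" where
  "sinh_lam p = fps_to_fls
     (fps_compose (fps_const (1/2) * (fps_exp 1 - fps_exp (- 1))) (fps_X * p))"

text \<open>
  In the next two definitions \<open>sg\<close> is the root of \<open>\<gamma>\<close>, \<open>r\<close> the root of \<open>\<^bold>b\<^bold>c\<close> and \<open>p\<close> the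
  potential \<open>\<^bold>p\<close>.
\<close>

definition Vplus ::
  "complex \<Rightarrow> 'm cmc_data \<Rightarrow> ('m \<Rightarrow> complex fls) \<Rightarrow> ('m \<Rightarrow> complex fps) \<Rightarrow> 'm \<Rightarrow> lmat" where
  "Vplus sg S r p q =
    (let a = bold_a S q; b = bold_b S q; c = bold_c S q;
         ch = cosh_lam (p q); sh = sinh_lam (p q)
     in msc (1 / (2 * r q)) (mat22
          (2 * sh * lam_inv * b * c)
          (2 * cst sg * ch * c + cst \<i> * sh * lam_inv * a * c)
          (- 2 * cst sg * ch * b + cst \<i> * sh * lam_inv * a * b)
          (- 2 * sh * lam_inv * b * c)))"

definition Vminus ::
  "complex \<Rightarrow> 'm cmc_data \<Rightarrow> ('m \<Rightarrow> complex fls) \<Rightarrow> ('m \<Rightarrow> complex fps) \<Rightarrow> 'm \<Rightarrow> lmat" where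
  "Vminus sg S r p q =
    (let a = bold_a S q; b = bold_b S q; c = bold_c S q;
         ch = cosh_lam (p q); sh = sinh_lam (p q)
     in msc (1 / (2 * r q)) (mat22
          (- 2 * ch * b * c)
          (- 2 * cst sg * sh * lam * c - cst \<i> * ch * a * c)
          (2 * cst sg * sh * lam * b - cst \<i> * ch * a * b)
          (2 * ch * b * c)))"

text \<open>
  Laurent polynomials \<open>\<Sum> f\<^sub>k E\<^sup>k\<close> in the formal invertible symbol \<open>E = exp (4 \<surd>\<gamma> \<lambda> \<tt>)\<close>, with
  coefficients in the Laurent series: the group ring of the integers, with \<open>E\<^sup>k\<close> at \<open>k\<close>.
\<close>

type_synonym ext = "int \<Rightarrow>\<^sub>0 complex fls"

definition lift :: "complex fls \<Rightarrow> ext" where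
  "lift f = Poly_Mapping.single 0 f"

definition Esym :: "int \<Rightarrow> ext" where
  "Esym k = Poly_Mapping.single k 1"

definition cosh_E :: ext where
  "cosh_E = lift (cst (1/2)) * (Esym 1 + Esym (- 1))"

definition sinh_E :: ext where
  "sinh_E = lift (cst (1/2)) * (Esym 1 - Esym (- 1))"

text \<open>The Euler operator on \<open>ext\<close>, where \<open>E\<^sup>k\<close> has derivative \<open>4 k \<surd>\<gamma> (\<lambda> \<tt>)\<^sup>\<cdot> E\<^sup>k\<close>.\<close>

definition euler_ext :: "nat \<Rightarrow> complex \<Rightarrow> 'm cmc_data \<Rightarrow> 'm \<Rightarrow> ext \<Rightarrow> ext" where
  "euler_ext N sg S q F = Poly_Mapping.mapp
     (\<lambda>k f. euler f + of_int k * cst (4 * sg) * euler (lam * tfrak N S q) * f) F"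

definition Pplus ::
  "complex \<Rightarrow> 'm cmc_data \<Rightarrow> ('m \<Rightarrow> complex fls) \<Rightarrow> ('m \<Rightarrow> complex fps) \<Rightarrow> 'm \<Rightarrow> ext^2^2" where
  "Pplus sg S r p q =
     msc cosh_E (map_matrix lift (Vplus sg S r p q))
     - msc (lift lam_inv * sinh_E) (map_matrix lift (Vminus sg S r p q))"

definition Pminus ::
  "complex \<Rightarrow> 'm cmc_data \<Rightarrow> ('m \<Rightarrow> complex fls) \<Rightarrow> ('m \<Rightarrow> complex fps) \<Rightarrow> 'm \<Rightarrow> ext^2^2" where
  "Pminus sg S r p q =
     - msc (lift lam * sinh_E) (map_matrix lift (Vplus sg S r p q))
     + msc cosh_E (map_matrix lift (Vminus sg S r p q))"

definition spectral_S ::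
  "nat \<Rightarrow> complex \<Rightarrow> complex \<Rightarrow> 'm cmc_data \<Rightarrow> ('m \<Rightarrow> complex fls) \<Rightarrow> ('m \<Rightarrow> complex fps) \<Rightarrow>
   'm \<Rightarrow> ext^2^2" where
  "spectral_S N \<gamma> sg S r p q =
     map_matrix lift
       (msc (cst (1 / (32 * \<gamma>)) * lam_inv\<^sup>2) (comm (Ymat S q) (map_matrix euler (Ymat S q))))
     - msc (lift (cst (1 / (8 * \<gamma>))))
         (comm (Pplus sg S r p q) (map_matrix (euler_ext N sg S q) (Pplus sg S r p q)))
     + msc (lift (cst (1 / (8 * \<gamma>)) * lam_inv\<^sup>2))
         (comm (Pminus sg S r p q) (map_matrix (euler_ext N sg S q) (Pminus sg S r p q)))"

text \<open>
  A priori \<open>T\<close> has entries in \<open>ext\<close>; being \<open>g\<close>-valued means that no \<open>E\<close> occurs, i.e. that \<open>T\<close> is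
  the image of a \<open>g\<close>-valued function \<open>F\<close> under the inclusion \<open>lift\<close>.
\<close>

definition spectral_killing_field ::
  "('m, 'e::euclidean_space) atlas \<Rightarrow> nat \<Rightarrow> 'm cmc_data \<Rightarrow> ('m \<Rightarrow> ext^2^2) \<Rightarrow> bool" where
  "spectral_killing_field \<A> N S T \<longleftrightarrow> (\<exists>F. g_valued \<A> F \<and> (\<forall>q. T q = map_matrix lift (F q)) \<and>
     (\<forall>q. \<forall>v \<in> tangent_space \<A> q.
        dmat v F + comm (phi N S q v) (F q) = map_matrix euler (phi N S q v)))"

end

theory Submission
  imports Defs
begin

text \<open>
  The symbol \<open>E\<close> drops out because \<open>P\<^sub>+ = R + T\<close> and \<open>P\<^sub>- = \<lambda> (T - R)\<close>, where \<open>R\<close> is a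
  multiple of \<open>E\<close> and \<open>T\<close> a multiple of \<open>E\<^sup>-\<^sup>1\<close>: the two commutators in \<open>S\<close> then combine to
  the mixed terms \<open>[R, T']\<close> and \<open>[T, R']\<close>, a prime denoting the Euler operator. The same
  cancellation removes the exponentials of \<open>\<lambda> p\<close>, since \<open>R\<close> and \<open>T\<close> also carry the factors
  \<open>exp (\<lambda> p)\<close> and \<open>exp (- \<lambda> p)\<close>, and the root of \<open>b c\<close> enters only through its square. With
  \<open>a\<^sup>2 - 4 b c = - 4 \<gamma> \<lambda>\<^sup>2\<close> one is left with the explicit matrix
  \<open>((b'/b - c'/c)/4, i (a' - a)/(4 b); - i (a' - a)/(4 c), (c'/c - b'/b)/4) + (u + u') Y\<close>,
  \<open>u = t + p / (4 \<surd>\<gamma>)\<close>.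
  It is visibly twisted and has smooth coefficients, because \<open>b c\<close> has constant leading
  coefficient \<open>\<gamma>\<close>. Its Killing equation is an identity of rational functions, given
  \<open>dY = - [\<phi>, Y]\<close> and \<open>du = (\<phi>\<^sub>1\<^sub>2 / c + \<phi>\<^sub>2\<^sub>1 / b) / 4\<close>; in the latter the contribution of
  \<open>\<alpha> Y\<close> to \<open>dp\<close> cancels \<open>dt = \<alpha>\<close>.
\<close>

no_notation fps_nth (infixl "$" 75)

section \<open>Calculus of functions of class C^k on open sets, and of smooth functions in
  charts\<close>

section \<open>Smooth functions\<close>

text \<open>A derivative at a point of an open set depends only on the values nearby, so equality on
  the set passes to \<open>frechet_derivative\<close> and the induction can continue.\<close>

lemma Ck_on_cong:
  assumes "open S" "\<And>x. x \<in> S \<Longrightarrow> f x = g x" "Ck_on k S f"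
  shows "Ck_on k S g"
  using assms(2,3)
proof (induction k arbitrary: f g)
  case 0
  then show ?case using continuous_on_cong[OF refl, of S f g] by (auto simp only: Ck_on.simps)
next
  case (Suc k)
  have diff: "f differentiable_on S" and Ck: "Ck_on k S (\<lambda>x. frechet_derivative f (at x) v)" for v
    using Suc.prems(2) by (simp_all only: Ck_on.simps)
  have d: "f differentiable at x" if "x \<in> S" for x
    using diff differentiable_on_eq_differentiable_at[OF \<open>open S\<close>] that by blast
  have eq: "frechet_derivative f (at x) = frechet_derivative g (at x)" if "x \<in> S" for x
    using frechet_derivative_transform_within_open[OF d[OF that] \<open>open S\<close> that Suc.prems(1)] .
  have g: "g differentiable_on S"
    unfolding differentiable_on_eq_differentiable_at[OF \<open>open S\<close>]
    using d has_derivative_transform_within_open[of f _ _ UNIV S g] Suc.prems(1) \<open>open S\<close>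
    unfolding differentiable_def by metis
  have "Ck_on k S (\<lambda>x. frechet_derivative g (at x) v)" for v
  proof (rule Suc.IH[OF _ Ck])
    show "frechet_derivative f (at x) v = frechet_derivative g (at x) v" if "x \<in> S" for x
      by (simp only: eq[OF that])
  qed
  then show ?case using g unfolding Ck_on.simps by blast
qed

lemma Ck_on_Suc_lower: "Ck_on (Suc k) S f \<Longrightarrow> Ck_on k S f"
proof (induction k arbitrary: f)
  case 0
  then show ?case
    unfolding Ck_on.simps by (blast intro: differentiable_imp_continuous_on)
next
  case (Suc k)
  then show ?case
    unfolding Ck_on.simps(2)[of "Suc k" S f] Ck_on.simps(2)[of k S f] by blast
qed

text \<open>\<open>Ck_on\<close> speaks of the chosen \<open>frechet_derivative\<close>. Derivatives
  at points of an open set are unique, so an explicit \<open>f'\<close> may take its place; the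
  closure properties below are inductions with this rule.\<close>

lemma Ck_on_SucI:
  assumes "open S" "\<And>x. x \<in> S \<Longrightarrow> (f has_derivative f' x) (at x)"
    and "\<And>v. Ck_on k S (\<lambda>x. f' x v)"
  shows "Ck_on (Suc k) S f"
proof -
  have eq: "f' x = frechet_derivative f (at x)" if "x \<in> S" for x
    by (rule frechet_derivative_at[OF assms(2)[OF that]])
  have "Ck_on k S (\<lambda>x. frechet_derivative f (at x) v)" for v
    by (rule Ck_on_cong[OF \<open>open S\<close> _ assms(3)[of v]]) (simp only: eq)
  moreover have "f differentiable_on S"
    unfolding differentiable_on_eq_differentiable_at[OF \<open>open S\<close>] differentiable_def
    using assms(2) by blast
  ultimately show ?thesis unfolding Ck_on.simps by blast
qed

lemma Ck_on_SucD:
  assumes "open S" "Ck_on (Suc k) S f" "x \<in> S"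
  shows "(f has_derivative frechet_derivative f (at x)) (at x)"
  using assms(2,3) unfolding Ck_on.simps differentiable_on_eq_differentiable_at[OF assms(1)]
    frechet_derivative_works by blast

lemma Ck_on_const: "Ck_on k S (\<lambda>x. c)"
  by (induction k arbitrary: c) simp_all

lemma Ck_on_bounded_linear:
  assumes "open S" "bounded_linear h" "Ck_on k S f"
  shows "Ck_on k S (\<lambda>x. h (f x))"
  using assms(3)
proof (induction k arbitrary: f)
  case 0
  then show ?case
    unfolding Ck_on.simps by (rule bounded_linear.continuous_on[OF assms(2)])
next
  case (Suc k)
  show ?case
  proof (rule Ck_on_SucI[OF \<open>open S\<close>])
    show "((\<lambda>x. h (f x)) has_derivative (\<lambda>v. h (frechet_derivative f (at x) v))) (at x)"
      if "x \<in> S" for x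
      using bounded_linear.has_derivative[OF assms(2) Ck_on_SucD[OF assms(1) Suc.prems that]] .
    show "Ck_on k S (\<lambda>x. h (frechet_derivative f (at x) v))" for v
      using Suc.prems by (intro Suc.IH) simp
  qed
qed

lemma Ck_on_add:
  assumes "open S" "Ck_on k S f" "Ck_on k S g"
  shows "Ck_on k S (\<lambda>x. f x + g x)"
  using assms(2,3)
proof (induction k arbitrary: f g)
  case 0
  then show ?case by (simp add: continuous_on_add)
next
  case (Suc k)
  show ?case
  proof (rule Ck_on_SucI[OF \<open>open S\<close>])
    show "((\<lambda>x. f x + g x) has_derivative
        (\<lambda>v. frechet_derivative f (at x) v + frechet_derivative g (at x) v)) (at x)"
      if "x \<in> S" for x
      using has_derivative_add[OF Ck_on_SucD[OF assms(1) Suc.prems(1) that] Ck_on_SucD[OF assms(1) Suc.prems(2) that]] .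
    show "Ck_on k S (\<lambda>x. frechet_derivative f (at x) v + frechet_derivative g (at x) v)" for v
      using Suc.prems by (intro Suc.IH) simp_all
  qed
qed

lemma Ck_on_mult:
  fixes f g :: "_ \<Rightarrow> 'b::real_normed_algebra"
  assumes "open S" "Ck_on k S f" "Ck_on k S g"
  shows "Ck_on k S (\<lambda>x. f x * g x)"
  using assms(2,3)
proof (induction k arbitrary: f g)
  case 0
  then show ?case by (simp add: continuous_on_mult)
next
  case (Suc k)
  show ?case
  proof (rule Ck_on_SucI[OF \<open>open S\<close>])
    show "((\<lambda>x. f x * g x) has_derivative
        (\<lambda>v. f x * frechet_derivative g (at x) v + frechet_derivative f (at x) v * g x)) (at x)"
      if "x \<in> S" for x
      using has_derivative_mult[OF Ck_on_SucD[OF assms(1) Suc.prems(1) that] Ck_on_SucD[OF assms(1) Suc.prems(2) that]] .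
    \<comment> \<open>The product rule keeps undifferentiated factors, which are of class C^k by
      \<open>Ck_on_Suc_lower\<close>.\<close>
    show "Ck_on k S (\<lambda>x. f x * frechet_derivative g (at x) v + frechet_derivative f (at x) v * g x)" for v
      using Suc.prems Ck_on_Suc_lower[OF Suc.prems(1)] Ck_on_Suc_lower[OF Suc.prems(2)]
      by (intro Ck_on_add[OF assms(1)] Suc.IH) simp_all
  qed
qed

lemma smooth_atlas_chart_open: "smooth_atlas \<A> \<Longrightarrow> (U, \<psi>) \<in> \<A> \<Longrightarrow> open (\<psi> ` U)"
  unfolding smooth_atlas_def by blast

lemma smooth_fun_iff:
  "smooth_fun \<A> f \<longleftrightarrow> (\<forall>(U, \<psi>)\<in>\<A>. \<forall>k. Ck_on k (\<psi> ` U) (\<lambda>x. f (inv_into U \<psi> x)))"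
  by (simp add: smooth_fun_def smooth_on_def comp_def)

lemma smooth_fun_const: "smooth_fun \<A> (\<lambda>q. c)"
  by (simp add: smooth_fun_iff Ck_on_const case_prod_unfold)

lemma smooth_fun_bounded_linear:
  assumes "smooth_atlas \<A>" "bounded_linear h" "smooth_fun \<A> f"
  shows "smooth_fun \<A> (\<lambda>q. h (f q))"
  unfolding smooth_fun_iff
proof safe
  fix U \<psi> k assume chart: "(U, \<psi>) \<in> \<A>"
  show "Ck_on k (\<psi> ` U) (\<lambda>x. h (f (inv_into U \<psi> x)))"
    using assms(3) chart unfolding smooth_fun_iff
    by (intro Ck_on_bounded_linear[OF smooth_atlas_chart_open[OF assms(1) chart] assms(2)]) blast
qed

lemma smooth_fun_add:
  assumes "smooth_atlas \<A>" "smooth_fun \<A> f" "smooth_fun \<A> g"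
  shows "smooth_fun \<A> (\<lambda>q. f q + g q)"
  unfolding smooth_fun_iff
proof safe
  fix U \<psi> k assume chart: "(U, \<psi>) \<in> \<A>"
  show "Ck_on k (\<psi> ` U) (\<lambda>x. f (inv_into U \<psi> x) + g (inv_into U \<psi> x))"
    using assms(2,3) chart unfolding smooth_fun_iff
    by (intro Ck_on_add[OF smooth_atlas_chart_open[OF assms(1) chart]]) blast+
qed

lemma smooth_fun_mult:
  fixes f g :: "_ \<Rightarrow> 'b::real_normed_algebra"
  assumes "smooth_atlas \<A>" "smooth_fun \<A> f" "smooth_fun \<A> g"
  shows "smooth_fun \<A> (\<lambda>q. f q * g q)"
  unfolding smooth_fun_iff
proof safe
  fix U \<psi> k assume chart: "(U, \<psi>) \<in> \<A>"
  show "Ck_on k (\<psi> ` U) (\<lambda>x. f (inv_into U \<psi> x) * g (inv_into U \<psi> x))"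
    using assms(2,3) chart unfolding smooth_fun_iff
    by (intro Ck_on_mult[OF smooth_atlas_chart_open[OF assms(1) chart]]) blast+
qed

lemma smooth_fun_sum:
  assumes "smooth_atlas \<A>" "\<And>i. i \<in> I \<Longrightarrow> smooth_fun \<A> (f i)"
  shows "smooth_fun \<A> (\<lambda>q. \<Sum>i\<in>I. f i q)"
  using assms(2)
  by (induction I rule: infinite_finite_induct)
    (auto intro: smooth_fun_const smooth_fun_add[OF assms(1)])

section \<open>Closure of Laurent series with smooth coefficients under the algebraic
  operations\<close>

section \<open>Laurent series with smooth coefficients\<close>

text \<open>The library formula sums between bounds given by the subdegrees, which vary from point
  to point of the manifold. Bounds common to all points give a finite sum over a fixed index set,
  which can be shown smooth and differentiated term by term.\<close>

lemma fls_times_nth_bounds: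
  fixes f g :: "'a::semiring_0 fls"
  assumes "\<And>i. i < k \<Longrightarrow> fls_nth f i = 0" and "\<And>i. i < l \<Longrightarrow> fls_nth g i = 0"
  shows "fls_nth (f * g) n = (\<Sum>i=k..n - l. fls_nth f i * fls_nth g (n - i))"
proof (cases "f = 0 \<or> g = 0")
  case False
  then have "k \<le> fls_subdegree f" "l \<le> fls_subdegree g"
    using assms by (auto intro: fls_subdegree_geI)
  then have "(\<Sum>i=fls_subdegree f..n - fls_subdegree g. fls_nth f i * fls_nth g (n - i)) =
      (\<Sum>i=k..n - l. fls_nth f i * fls_nth g (n - i))"
    by (intro sum.mono_neutral_left) auto
  then show ?thesis by (simp add: fls_times_nth(2))
qed auto

lemma smooth_fls_const: "smooth_fls \<A> (\<lambda>q. f)"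
  unfolding smooth_fls_def
  by (auto simp: smooth_fun_const intro: exI[of _ "fls_subdegree f"])

lemma smooth_fls_add:
  assumes "smooth_atlas \<A>" "smooth_fls \<A> f" "smooth_fls \<A> g"
  shows "smooth_fls \<A> (\<lambda>q. f q + g q)"
proof -
  obtain k l where kl: "\<And>q n. n < k \<Longrightarrow> fls_nth (f q) n = 0" "\<And>q n. n < l \<Longrightarrow> fls_nth (g q) n = 0"
    using assms unfolding smooth_fls_def by blast
  have "\<forall>q. \<forall>n<min k l. fls_nth (f q + g q) n = 0"
    by (simp add: kl)
  moreover have "smooth_fun \<A> (\<lambda>q. fls_nth (f q + g q) n)" for n
    using assms unfolding smooth_fls_def fls_plus_nth by (intro smooth_fun_add) simp_all
  ultimately show ?thesis unfolding smooth_fls_def by blast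
qed

lemma smooth_fls_mult:
  assumes "smooth_atlas \<A>" "smooth_fls \<A> f" "smooth_fls \<A> g"
  shows "smooth_fls \<A> (\<lambda>q. f q * g q)"
proof -
  obtain k l where kl: "\<And>q n. n < k \<Longrightarrow> fls_nth (f q) n = 0" "\<And>q n. n < l \<Longrightarrow> fls_nth (g q) n = 0"
    using assms unfolding smooth_fls_def by blast
  have nth: "fls_nth (f q * g q) n = (\<Sum>i=k..n - l. fls_nth (f q) i * fls_nth (g q) (n - i))" for q n
    by (rule fls_times_nth_bounds) (simp_all add: kl)
  then have "\<forall>q. \<forall>n<k + l. fls_nth (f q * g q) n = 0"
    by simp
  moreover have "smooth_fun \<A> (\<lambda>q. fls_nth (f q * g q) n)" for n
    unfolding nth using assms
    by (intro smooth_fun_sum smooth_fun_mult) (auto simp: smooth_fls_def)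
  ultimately show ?thesis unfolding smooth_fls_def by blast
qed

lemma smooth_fls_uminus:
  assumes "smooth_atlas \<A>" "smooth_fls \<A> f"
  shows "smooth_fls \<A> (\<lambda>q. - f q)"
  using smooth_fls_mult[OF assms(1) smooth_fls_const[of _ "-1"] assms(2)] by simp

lemma smooth_fls_diff:
  assumes "smooth_atlas \<A>" "smooth_fls \<A> f" "smooth_fls \<A> g"
  shows "smooth_fls \<A> (\<lambda>q. f q - g q)"
  using smooth_fls_add[OF assms(1,2) smooth_fls_uminus[OF assms(1,3)]] by simp

lemma smooth_fls_sum:
  assumes "smooth_atlas \<A>" "\<And>i. i \<in> I \<Longrightarrow> smooth_fls \<A> (f i)"
  shows "smooth_fls \<A> (\<lambda>q. \<Sum>i\<in>I. f i q)"
  using assms(2)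
  by (induction I rule: infinite_finite_induct)
    (auto intro: smooth_fls_const smooth_fls_add[OF assms(1)])

lemma euler_nth [simp]: "fls_nth (euler f) n = of_int n * fls_nth f n"
  by (simp add: euler_def fls_X_times_conv_shift)

lemma smooth_fls_euler:
  assumes "smooth_atlas \<A>" "smooth_fls \<A> f"
  shows "smooth_fls \<A> (\<lambda>q. euler (f q))"
  unfolding smooth_fls_def
proof (intro conjI allI)
  show "smooth_fun \<A> (\<lambda>q. fls_nth (euler (f q)) n)" for n
    using assms unfolding smooth_fls_def euler_nth
    by (intro smooth_fun_mult smooth_fun_const) simp_all
  show "\<exists>k. \<forall>q. \<forall>n<k. fls_nth (euler (f q)) n = 0"
    using assms(2) unfolding smooth_fls_def euler_nth by (metis mult_zero_right)
qed

lemma smooth_fls_fps_to_fls: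
  assumes "\<And>n. smooth_fun \<A> (\<lambda>q. fps_nth (f q) n)"
  shows "smooth_fls \<A> (\<lambda>q. fps_to_fls (f q))"
  unfolding smooth_fls_def
proof (intro conjI allI)
  show "smooth_fun \<A> (\<lambda>q. fls_nth (fps_to_fls (f q)) n)" for n
    by (cases "n < 0") (simp_all add: smooth_fun_const assms)
  show "\<exists>k. \<forall>q. \<forall>n<k. fls_nth (fps_to_fls (f q)) n = 0"
    by (auto intro: exI[of _ 0])
qed

section \<open>Even and odd series in \<lambda>\<close>

text \<open>Parity is a boolean, \<open>True\<close> for even: the twist condition on the entry at
  \<open>i\<close>, \<open>j\<close> becomes \<open>fls_parity (i = j)\<close>, and parities of
  factors combine by \<open>=\<close>.\<close>

definition fls_parity :: "bool \<Rightarrow> complex fls \<Rightarrow> bool" where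
  "fls_parity e f \<longleftrightarrow> (\<forall>n. fls_nth f n \<noteq> 0 \<longrightarrow> even n = e)"

lemma fls_parity_add: "fls_parity e f \<Longrightarrow> fls_parity e g \<Longrightarrow> fls_parity e (f + g)"
  unfolding fls_parity_def by (metis add.right_neutral fls_plus_nth)

lemma fls_parity_uminus: "fls_parity e f \<Longrightarrow> fls_parity e (- f)"
  unfolding fls_parity_def by simp

lemma fls_parity_diff: "fls_parity e f \<Longrightarrow> fls_parity e g \<Longrightarrow> fls_parity e (f - g)"
  using fls_parity_add[OF _ fls_parity_uminus] by fastforce

lemma fls_parity_mult:
  assumes "fls_parity d f" "fls_parity e g"
  shows "fls_parity (d = e) (f * g)"
  unfolding fls_parity_def
proof (intro allI impI)
  fix n assume "fls_nth (f * g) n \<noteq> 0"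
  then obtain i where "fls_nth f i * fls_nth g (n - i) \<noteq> 0"
    unfolding fls_times_nth(2) by (meson sum.not_neutral_contains_not_neutral)
  then have "even i = d" "even (n - i) = e"
    using assms unfolding fls_parity_def by auto
  then show "even n = (d = e)" by auto
qed

lemma fls_parity_euler: "fls_parity e f \<Longrightarrow> fls_parity e (euler f)"
  unfolding fls_parity_def by auto

lemma fls_parity_cst: "fls_parity True (cst c)"
  unfolding fls_parity_def by simp

lemma fls_parity_0 [simp]: "fls_parity e 0"
  unfolding fls_parity_def by simp

lemma fls_parity_sum: "(\<And>i. i \<in> I \<Longrightarrow> fls_parity e (f i)) \<Longrightarrow> fls_parity e (\<Sum>i\<in>I. f i)"
  by (induction I rule: infinite_finite_induct) (auto intro: fls_parity_add)

section \<open>Inverses of series: smooth coefficients and parity\<close>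

lemma fps_inverse_nth_Suc:
  "fps_nth (inverse f) (Suc n) =
     - inverse (fps_nth f 0) * (\<Sum>i=1..Suc n. fps_nth f i * fps_nth (inverse f) (Suc n - i))"
  for f :: "'a::field fps"
  by (simp add: fps_inverse_def del: sum.cl_ivl_Suc)

text \<open>The recursion divides only by the leading coefficient. As this is the constant
  \<open>c\<close>, every coefficient of the inverse is a polynomial in smooth functions.\<close>

lemma smooth_fps_inverse:
  assumes "smooth_atlas \<A>" "\<And>n. smooth_fun \<A> (\<lambda>q. fps_nth (f q) n)" "\<And>q. fps_nth (f q) 0 = c"
  shows "smooth_fun \<A> (\<lambda>q. fps_nth (inverse (f q :: complex fps)) n)"
proof (induction n rule: less_induct)
  case (less n)
  show ?case
  proof (cases n)
    case 0
    then show ?thesis by (simp add: assms(3) smooth_fun_const)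
  next
    case (Suc m)
    show ?thesis
      unfolding Suc fps_inverse_nth_Suc assms(3)
      using less Suc assms(2)
      by (intro smooth_fun_mult smooth_fun_sum smooth_fun_const assms(1)) auto
  qed
qed

lemma fps_inverse_nth_odd:
  assumes "\<And>n. odd n \<Longrightarrow> fps_nth f n = (0 :: 'a::field)" "odd n"
  shows "fps_nth (inverse f) n = 0"
  using assms(2)
proof (induction n rule: less_induct)
  case (less n)
  then obtain m where n: "n = Suc m" by (cases n) auto
  \<comment> \<open>The indices \<open>i\<close> and \<open>Suc m - i\<close> have odd sum. If
    \<open>i\<close> is odd the first factor vanishes; otherwise \<open>Suc m - i\<close> is odd and
    smaller, and the induction hypothesis applies.\<close>
  have "fps_nth f i * fps_nth (inverse f) (Suc m - i) = 0" if "i \<in> {1..Suc m}" for i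
    using that assms(1)[of i] less.IH[of "Suc m - i"] less.prems n by (cases "odd i") auto
  then have "(\<Sum>i=1..Suc m. fps_nth f i * fps_nth (inverse f) (Suc m - i)) = 0"
    by (rule sum.neutral[rule_format])
  then show ?case unfolding n fps_inverse_nth_Suc by (simp only: mult_zero_right)
qed

text \<open>Splitting off \<lambda>^k leaves a power series with nonzero constant term, which is
  invertible among power series.\<close>

lemma fls_inverse_conv_fps:
  fixes f :: "'a::field fls"
  assumes "\<And>n. n < k \<Longrightarrow> fls_nth f n = 0" "fls_nth f k \<noteq> 0"
  shows "inverse f = fls_shift k (fps_to_fls (inverse (fls_regpart (fls_shift k f))))"
proof -
  have sub: "fls_subdegree f = k"
    using assms by (auto intro: fls_subdegree_eqI)
  let ?g = "fls_regpart (fls_shift k f)"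
  have "fps_to_fls ?g = fls_shift k f"
    by (rule fls_eqI) (auto simp: assms)
  then have f: "f = fls_shift (- k) (fps_to_fls ?g)" by simp
  have "fps_nth ?g 0 \<noteq> 0" using assms by simp
  then have g: "fps_to_fls ?g * fps_to_fls (inverse ?g) = 1"
    by (simp add: inverse_mult_eq_1' flip: fls_times_fps_to_fls)
  have "f * fls_shift k (fps_to_fls (inverse ?g)) = 1"
    by (subst f) (simp add: fls_shifted_times_simps g)
  then show ?thesis by (metis inverse_unique)
qed

lemma smooth_fls_inverse:
  assumes "smooth_atlas \<A>" "smooth_fls \<A> f"
    and "\<And>q n. n < k \<Longrightarrow> fls_nth (f q) n = 0" "\<And>q. fls_nth (f q) k = c" "c \<noteq> 0"
  shows "smooth_fls \<A> (\<lambda>q. inverse (f q))"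
proof -
  have eq: "inverse (f q) = fls_shift k (fps_to_fls (inverse (fls_regpart (fls_shift k (f q)))))" for q
    using assms by (intro fls_inverse_conv_fps) auto
  have sm: "smooth_fun \<A> (\<lambda>q. fps_nth (inverse (fls_regpart (fls_shift k (f q)))) n)" for n
    using assms by (intro smooth_fps_inverse[where c = c]) (auto simp: smooth_fls_def)
  show ?thesis
    unfolding eq smooth_fls_def
  proof (intro conjI allI)
    fix n
    show "smooth_fun \<A> (\<lambda>q. fls_nth
        (fls_shift k (fps_to_fls (inverse (fls_regpart (fls_shift k (f q)))))) n)"
      by (cases "n + k < 0") (simp_all add: sm smooth_fun_const)
  qed (auto intro: exI[of _ "- k"])
qed

lemma fls_parity_inverse:
  assumes "\<And>n. n < k \<Longrightarrow> fls_nth f n = 0" "fls_nth f k \<noteq> 0" "fls_parity True f"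
  shows "fls_parity True (inverse f)"
proof -
  have "even k" using assms(2,3) by (auto simp: fls_parity_def)
  then have "fps_nth (inverse (fls_regpart (fls_shift k f))) n = 0" if "odd n" for n
    using assms(3) that by (intro fps_inverse_nth_odd) (auto simp: fls_parity_def)
  then have "fls_nth (inverse f) n = 0" if "odd n" for n
    using \<open>even k\<close> that
    by (subst fls_inverse_conv_fps[OF assms(1,2)]) (auto simp: even_nat_iff)
  then show ?thesis
    unfolding fls_parity_def by auto
qed

section \<open>Derivation rules for \<open>dC\<close> and \<open>dfls\<close> along a fixed tangent
  vector\<close>

section \<open>Derivations along tangent vectors\<close>

context
  fixes \<A> :: "('m::{t2_space, second_countable_topology}, 'e::euclidean_space) atlas"
    and v :: "'m tvec" and q :: 'm
  assumes atlas: "smooth_atlas \<A>" and v: "v \<in> tangent_space \<A> q"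
begin

lemma smooth_fun_Re: "smooth_fun \<A> f \<Longrightarrow> smooth_fun \<A> (\<lambda>x. Re (f x))"
  using smooth_fun_bounded_linear[OF atlas bounded_linear_Re] .

lemma smooth_fun_Im: "smooth_fun \<A> f \<Longrightarrow> smooth_fun \<A> (\<lambda>x. Im (f x))"
  using smooth_fun_bounded_linear[OF atlas bounded_linear_Im] .

lemma tangent_linear:
  "smooth_fun \<A> f \<Longrightarrow> smooth_fun \<A> g \<Longrightarrow> v (\<lambda>x. a * f x + b * g x) = a * v f + b * v g"
  using v unfolding tangent_space_def by blast

lemma tangent_add: "smooth_fun \<A> f \<Longrightarrow> smooth_fun \<A> g \<Longrightarrow> v (\<lambda>x. f x + g x) = v f + v g"
  using tangent_linear[of f g 1 1] by simp

lemma tangent_diff: "smooth_fun \<A> f \<Longrightarrow> smooth_fun \<A> g \<Longrightarrow> v (\<lambda>x. f x - g x) = v f - v g"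
  using tangent_linear[of f g 1 "-1"] by simp

lemma tangent_mult:
  "smooth_fun \<A> f \<Longrightarrow> smooth_fun \<A> g \<Longrightarrow> v (\<lambda>x. f x * g x) = f q * v g + g q * v f"
  using v unfolding tangent_space_def by blast

lemma tangent_const: "v (\<lambda>x. c) = 0"
proof -
  \<comment> \<open>The Leibniz rule for 1 = 1 * 1 gives v(1) = 2 v(1).\<close>
  have "v (\<lambda>x. 1) = 0"
    using tangent_mult[of "\<lambda>x. 1" "\<lambda>x. 1"] by (simp add: smooth_fun_const)
  then show ?thesis
    using tangent_linear[of "\<lambda>x. 1" "\<lambda>x. 1" c 0] by (simp add: smooth_fun_const)
qed

lemma dC_const: "dC v (\<lambda>x. c) = 0"
  by (simp add: dC_def tangent_const complex_eq_iff)

lemma dC_add: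
  assumes "smooth_fun \<A> f" "smooth_fun \<A> g"
  shows "dC v (\<lambda>x. f x + g x) = dC v f + dC v g"
  using assms by (simp add: dC_def tangent_add smooth_fun_Re smooth_fun_Im complex_eq_iff)

lemma dC_mult:
  assumes "smooth_fun \<A> f" "smooth_fun \<A> g"
  shows "dC v (\<lambda>x. f x * g x) = f q * dC v g + g q * dC v f"
proof -
  note [simp] = smooth_fun_Re[OF assms(1)] smooth_fun_Im[OF assms(1)]
    smooth_fun_Re[OF assms(2)] smooth_fun_Im[OF assms(2)]
  note [simp] = smooth_fun_mult[OF atlas, where 'b = real]
  show ?thesis
    by (simp add: dC_def tangent_add tangent_diff tangent_mult complex_eq_iff algebra_simps
        del: tangent_linear)
qed

lemma dC_sum:
  assumes "\<And>i. i \<in> I \<Longrightarrow> smooth_fun \<A> (f i)"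
  shows "dC v (\<lambda>x. \<Sum>i\<in>I. f i x) = (\<Sum>i\<in>I. dC v (f i))"
  using assms
  by (induction I rule: infinite_finite_induct)
    (simp_all add: dC_const dC_add smooth_fun_sum[OF atlas])

lemma smooth_flsD: "smooth_fls \<A> F \<Longrightarrow> smooth_fun \<A> (\<lambda>x. fls_nth (F x) n)"
  by (simp add: smooth_fls_def)

text \<open>\<open>Abs_fls\<close> can be read coefficientwise only if the coefficients vanish below
  some index. The bound in \<open>smooth_fls\<close> is uniform in the point, so below it the
  functions differentiated are identically 0.\<close>

lemma dfls_nth:
  assumes "smooth_fls \<A> F"
  shows "fls_nth (dfls v F) n = dC v (\<lambda>x. fls_nth (F x) n)"
proof -
  obtain k where "\<And>x n. n < k \<Longrightarrow> fls_nth (F x) n = 0"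
    using assms unfolding smooth_fls_def by blast
  then have "\<forall>n<k. dC v (\<lambda>x. fls_nth (F x) n) = 0"
    by (simp add: dC_const)
  then show ?thesis
    unfolding dfls_def by (rule nth_Abs_fls_lower_bound)
qed

lemma dfls_const: "dfls v (\<lambda>x. f) = 0"
  by (rule fls_eqI) (simp add: dfls_nth smooth_fls_const dC_const)

lemma dfls_add:
  assumes "smooth_fls \<A> F" "smooth_fls \<A> G"
  shows "dfls v (\<lambda>x. F x + G x) = dfls v F + dfls v G"
  using assms
  by (intro fls_eqI) (simp add: dfls_nth smooth_fls_add[OF atlas] dC_add smooth_flsD)

text \<open>With uniform lower bounds each coefficient of the product is a finite sum, to which the
  scalar Leibniz rule applies; the differentiated series obey the same bounds.\<close>

lemma dfls_mult:
  assumes F: "smooth_fls \<A> F" and G: "smooth_fls \<A> G"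
  shows "dfls v (\<lambda>x. F x * G x) = F q * dfls v G + dfls v F * G q"
proof (rule fls_eqI)
  fix n
  obtain k l where k: "\<And>x n. n < k \<Longrightarrow> fls_nth (F x) n = 0"
    and l: "\<And>x n. n < l \<Longrightarrow> fls_nth (G x) n = 0"
    using assms unfolding smooth_fls_def by blast
  have dk: "fls_nth (dfls v F) n = 0" if "n < k" for n
    using k that by (simp add: dfls_nth[OF F] dC_const)
  have dl: "fls_nth (dfls v G) n = 0" if "n < l" for n
    using l that by (simp add: dfls_nth[OF G] dC_const)
  have sm: "smooth_fun \<A> (\<lambda>x. fls_nth (F x) n)" "smooth_fun \<A> (\<lambda>x. fls_nth (G x) n)" for n
    using assms by (simp_all add: smooth_fls_def)
  have "fls_nth (dfls v (\<lambda>x. F x * G x)) n =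
      dC v (\<lambda>x. \<Sum>i=k..n - l. fls_nth (F x) i * fls_nth (G x) (n - i))"
    using k l by (simp add: dfls_nth[OF smooth_fls_mult[OF atlas F G]]
        fls_times_nth_bounds[where k = k and l = l])
  also have "\<dots> = (\<Sum>i=k..n - l. fls_nth (F q) i * fls_nth (dfls v G) (n - i) +
      fls_nth (dfls v F) i * fls_nth (G q) (n - i))"
    by (simp add: dC_sum dC_mult sm smooth_fun_mult[OF atlas] dfls_nth[OF F] dfls_nth[OF G]
        mult.commute)
  also have "\<dots> = fls_nth (F q * dfls v G + dfls v F * G q) n"
    using k l dk dl
    by (simp add: fls_times_nth_bounds[where k = k and l = l] sum.distrib)
  finally show "fls_nth (dfls v (\<lambda>x. F x * G x)) n = fls_nth (F q * dfls v G + dfls v F * G q) n" .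
qed

lemma dfls_uminus:
  assumes "smooth_fls \<A> F"
  shows "dfls v (\<lambda>x. - F x) = - dfls v F"
  using dfls_mult[OF smooth_fls_const[of \<A> "-1"] assms] by (simp add: dfls_const)

lemma dfls_diff:
  assumes "smooth_fls \<A> F" "smooth_fls \<A> G"
  shows "dfls v (\<lambda>x. F x - G x) = dfls v F - dfls v G"
  using dfls_add[OF assms(1) smooth_fls_uminus[OF atlas assms(2)]]
  by (simp add: dfls_uminus[OF assms(2)])

text \<open>The Euler operator multiplies the coefficient of \<lambda>^n by the constant n, and
  constants pass through the derivation.\<close>

lemma dfls_euler:
  assumes "smooth_fls \<A> F"
  shows "dfls v (\<lambda>x. euler (F x)) = euler (dfls v F)"
  using assms
  by (intro fls_eqI)
    (simp add: dfls_nth smooth_fls_euler[OF atlas] dC_mult dC_const smooth_fun_const smooth_flsD)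

lemma dfls_inverse:
  assumes "smooth_fls \<A> F" "smooth_fls \<A> (\<lambda>x. inverse (F x))" "\<And>x. F x \<noteq> 0"
  shows "dfls v (\<lambda>x. inverse (F x)) = - dfls v F / (F q)\<^sup>2"
proof -
  have "0 = dfls v (\<lambda>x. F x * inverse (F x))"
    using assms(3) by (simp add: dfls_const)
  also have "\<dots> = F q * dfls v (\<lambda>x. inverse (F x)) + dfls v F * inverse (F q)"
    by (rule dfls_mult[OF assms(1,2)])
  finally show ?thesis
    using assms(3)[of q] by (simp add: field_simps power2_eq_square flip: eq_neg_iff_add_eq_0)
qed

end

section \<open>The Euler operator as a derivation, and entrywise matrix arithmetic\<close>

section \<open>The Euler operator and two by two matrices\<close>

lemma euler_add: "euler (f + g) = euler f + euler g"
  by (simp add: euler_def algebra_simps)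

lemma euler_diff: "euler (f - g) = euler f - euler g"
  by (simp add: euler_def algebra_simps)

lemma euler_uminus: "euler (- f) = - euler f"
  by (simp add: euler_def)

lemma euler_mult: "euler (f * g) = euler f * g + f * euler g"
  by (simp add: euler_def algebra_simps)

lemma euler_cst [simp]: "euler (cst c) = 0"
  by (simp add: euler_def)

lemma euler_numeral [simp]: "euler (numeral k) = 0"
  by (simp add: euler_def)

lemma euler_0 [simp]: "euler 0 = 0"
  by (simp add: euler_def)

lemma euler_1 [simp]: "euler 1 = 0"
  by (simp add: euler_def)

lemma euler_lam: "euler lam = lam"
  by (simp add: euler_def)

lemma lam_lam_inv: "lam * lam_inv = 1"
  by (simp add: fls_X_inv_times_conv_shift)

lemma euler_lam_inv: "euler lam_inv = - lam_inv"
proof -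
  have "0 = euler (lam * lam_inv)" by (simp only: lam_lam_inv euler_1)
  also have "\<dots> = 1 + lam * euler lam_inv" unfolding euler_mult euler_lam by (simp only: lam_lam_inv)
  finally have "lam_inv * (1 + lam * euler lam_inv) = 0" by simp
  then have "lam_inv + (lam * lam_inv) * euler lam_inv = 0" by (simp add: algebra_simps)
  then show ?thesis by (simp add: lam_lam_inv add_eq_0_iff)
qed

lemma mat22_nth [simp]:
  "mat22 x y z w $ 1 $ 1 = x" "mat22 x y z w $ 1 $ 2 = y"
  "mat22 x y z w $ 2 $ 1 = z" "mat22 x y z w $ 2 $ 2 = w"
  by (simp_all add: mat22_def)

lemma msc_nth [simp]: "msc x A $ i $ j = x * A $ i $ j"
  by (simp add: msc_def map_matrix_def)

lemma map_matrix_nth [simp]: "map_matrix f A $ i $ j = f (A $ i $ j)"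
  by (simp add: map_matrix_def)

lemma comm_nth: "comm A B $ i $ j = A $ i $ 1 * B $ 1 $ j + A $ i $ 2 * B $ 2 $ j
    - (B $ i $ 1 * A $ 1 $ j + B $ i $ 2 * A $ 2 $ j)"
  by (simp add: comm_def matrix_matrix_mult_def sum_2)

lemma eq22I:
  assumes "A $ 1 $ 1 = B $ 1 $ 1" "A $ 1 $ 2 = B $ 1 $ 2" "A $ 2 $ 1 = B $ 2 $ 1" "A $ 2 $ 2 = B $ 2 $ 2"
  shows "A = (B :: 'a^2^2)"
  using assms by (simp add: vec_eq_iff forall_2)

section \<open>Reduction of the commutators in S to coefficients free of the symbol E\<close>

section \<open>Eliminating the symbol \<open>E\<close>\<close>

text \<open>Sums f E + g E^-1: every entry of P_+ and P_- and of their Euler derivatives has this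
  shape, and a product of two of them involves only E^2, 1 and E^-2.\<close>

definition Epair :: "complex fls \<Rightarrow> complex fls \<Rightarrow> ext" where
  "Epair f g = Poly_Mapping.single 1 f + Poly_Mapping.single (- 1) g"

lemma Epair_mult:
  "Epair f g * Epair f' g' = Poly_Mapping.single 2 (f * f') + lift (f * g' + g * f')
     + Poly_Mapping.single (- 2) (g * g')"
  by (simp add: Epair_def lift_def distrib_left distrib_right mult_single single_add algebra_simps)

lemma lift_mult_Epair: "lift h * Epair f g = Epair (h * f) (h * g)"
  by (simp add: Epair_def lift_def distrib_left mult_single)

lemma Epair_mult_lift: "Epair f g * lift h = Epair (f * h) (g * h)"
  by (simp add: Epair_def lift_def distrib_right mult_single)

lemma Epair_add: "Epair f g + Epair f' g' = Epair (f + f') (g + g')"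
  by (simp add: Epair_def single_add)

lemma Epair_diff: "Epair f g - Epair f' g' = Epair (f - f') (g - g')"
  by (simp add: Epair_def single_diff)

lemma Epair_uminus: "- Epair f g = Epair (- f) (- g)"
  by (simp add: Epair_def single_uminus)

lemma cosh_E_conv: "cosh_E = Epair (cst (1/2)) (cst (1/2))"
  by (simp add: cosh_E_def Esym_def Epair_def lift_def distrib_left mult_single)

lemma sinh_E_conv: "sinh_E = Epair (cst (1/2)) (- cst (1/2))"
  by (simp add: sinh_E_def Esym_def Epair_def lift_def right_diff_distrib mult_single single_uminus)

lemma lookup_euler_ext:
  "Poly_Mapping.lookup (euler_ext N sg S q F) k =
     euler (Poly_Mapping.lookup F k)
       + of_int k * cst (4 * sg) * euler (lam * tfrak N S q) * Poly_Mapping.lookup F k"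
  by (simp add: euler_ext_def lookup_mapp in_keys_iff when_def)

lemma euler_ext_Epair:
  "euler_ext N sg S q (Epair f g) =
     Epair (euler f + cst (4 * sg) * euler (lam * tfrak N S q) * f)
           (euler g - cst (4 * sg) * euler (lam * tfrak N S q) * g)"
  by (rule poly_mapping_eqI)
    (auto simp: lookup_euler_ext Epair_def lookup_add lookup_single when_def)

lemma lift_simps:
  "lift (f + g) = lift f + lift g" "lift (f - g) = lift f - lift g" "lift (f * g) = lift f * lift g"
  by (simp_all add: lift_def single_add single_diff mult_single)

lemma lift_2: "lift 2 = 2"
  using lift_simps(1)[of 1 1] by (simp add: lift_def)

definition Ematrix :: "lmat \<Rightarrow> lmat \<Rightarrow> ext^2^2" where
  "Ematrix P Q = (\<chi> i j. Epair (P $ i $ j) (Q $ i $ j))"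

lemma Ematrix_nth [simp]: "Ematrix P Q $ i $ j = Epair (P $ i $ j) (Q $ i $ j)"
  by (simp add: Ematrix_def)

lemma comm_Ematrix_nth:
  "comm (Ematrix P Q) (Ematrix P' Q') $ i $ j =
     Poly_Mapping.single 2 (comm P P' $ i $ j) + lift ((comm P Q' + comm Q P') $ i $ j)
     + Poly_Mapping.single (- 2) (comm Q Q' $ i $ j)"
  by (simp add: comm_nth Epair_mult lift_def single_add single_diff algebra_simps)

lemma map_euler_ext_Ematrix:
  "map_matrix (euler_ext N sg S q) (Ematrix P Q) =
     Ematrix (map_matrix euler P + msc (cst (4 * sg) * euler (lam * tfrak N S q)) P)
             (map_matrix euler Q - msc (cst (4 * sg) * euler (lam * tfrak N S q)) Q)"
  by (simp add: vec_eq_iff euler_ext_Epair)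

text \<open>For V = V_+ and W = V_- these are the coefficients of E and E^-1 in P_+.\<close>

definition E_coeff :: "lmat \<Rightarrow> lmat \<Rightarrow> lmat" where
  "E_coeff V W = msc (cst (1/2)) (V - msc lam_inv W)"

definition E_inv_coeff :: "lmat \<Rightarrow> lmat \<Rightarrow> lmat" where
  "E_inv_coeff V W = msc (cst (1/2)) (V + msc lam_inv W)"

lemma Pplus_conv:
  "Pplus sg S r p q = Ematrix (E_coeff (Vplus sg S r p q) (Vminus sg S r p q))
     (E_inv_coeff (Vplus sg S r p q) (Vminus sg S r p q))"
  by (simp add: vec_eq_iff Pplus_def cosh_E_conv sinh_E_conv lift_mult_Epair Epair_mult_lift
      Epair_diff E_coeff_def E_inv_coeff_def algebra_simps)

lemma lam_cancel: "lam * (lam_inv * f) = f" "lam_inv * (lam * f) = f"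
  by (simp_all add: lam_lam_inv mult.commute[of lam_inv] flip: mult.assoc)

lemma Pminus_conv:
  "Pminus sg S r p q = Ematrix (msc (- lam) (E_coeff (Vplus sg S r p q) (Vminus sg S r p q)))
     (msc lam (E_inv_coeff (Vplus sg S r p q) (Vminus sg S r p q)))"
  by (simp add: vec_eq_iff Pminus_def cosh_E_conv sinh_E_conv lift_mult_Epair Epair_mult_lift
      Epair_add Epair_uminus E_coeff_def E_inv_coeff_def algebra_simps lam_cancel)

text \<open>The terms in E^2 and E^-2 of the P_- commutator are \<lambda>^2 times those of the P_+
  commutator, so they cancel after division by \<lambda>^2. The mixed terms appear with factor
  -\<lambda>^2 instead and therefore add up, whence the factor 2.\<close>

lemma spectral_S_conv:
  fixes N sg S r p q
  defines "P \<equiv> E_coeff (Vplus sg S r p q) (Vminus sg S r p q)"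
    and "Q \<equiv> E_inv_coeff (Vplus sg S r p q) (Vminus sg S r p q)"
    and "\<tau> \<equiv> cst (4 * sg) * euler (lam * tfrak N S q)"
  shows "spectral_S N \<gamma> sg S r p q = map_matrix lift
     (msc (cst (1 / (32 * \<gamma>)) * lam_inv\<^sup>2) (comm (Ymat S q) (map_matrix euler (Ymat S q)))
      - msc (2 * cst (1 / (8 * \<gamma>)))
         (comm P (map_matrix euler Q - msc \<tau> Q) + comm Q (map_matrix euler P + msc \<tau> P)))"
proof -
  let ?P' = "map_matrix euler P + msc \<tau> P" and ?Q' = "map_matrix euler Q - msc \<tau> Q"
  \<comment> \<open>The coefficients of E and E^-1 in P_-.\<close>
  let ?R = "msc (- lam) P" and ?T = "msc lam Q"
  let ?R' = "map_matrix euler ?R + msc \<tau> ?R" and ?T' = "map_matrix euler ?T - msc \<tau> ?T"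
  have l: "lam_inv\<^sup>2 * (lam * (lam * f)) = f" for f
    by (simp add: power2_eq_square lam_cancel mult.assoc)
  \<comment> \<open>Differentiating the factor \<lambda> only adds multiples of [P, P] and [Q, Q]
    here and in \<open>TT\<close>, and of [P, Q] + [Q, P] in \<open>RT\<close>; all of them
    vanish.\<close>
  have RR: "comm ?R ?R' $ i $ j = lam * lam * comm P ?P' $ i $ j" for i j
    by (simp add: comm_nth euler_mult euler_lam euler_uminus algebra_simps)
  have TT: "comm ?T ?T' $ i $ j = lam * lam * comm Q ?Q' $ i $ j" for i j
    by (simp add: comm_nth euler_mult euler_lam euler_uminus algebra_simps)
  have RT: "(comm ?R ?T' + comm ?T ?R') $ i $ j = - (lam * lam * (comm P ?Q' + comm Q ?P') $ i $ j)" for i j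
    by (simp add: comm_nth euler_mult euler_lam euler_uminus algebra_simps)
  have *: "lift (cst (1 / (8 * \<gamma>)) * lam_inv\<^sup>2) * comm (Ematrix ?R ?T) (Ematrix ?R' ?T') $ i $ j =
     lift (cst (1 / (8 * \<gamma>))) * (Poly_Mapping.single 2 (comm P ?P' $ i $ j)
       - lift ((comm P ?Q' + comm Q ?P') $ i $ j) + Poly_Mapping.single (- 2) (comm Q ?Q' $ i $ j))" for i j
    unfolding comm_Ematrix_nth RR TT RT
    by (simp add: lift_def distrib_left right_diff_distrib mult_single single_uminus single_add
        single_diff l mult.assoc)
  have 1: "spectral_S N \<gamma> sg S r p q $ i $ j =
      lift (cst (1 / (32 * \<gamma>)) * lam_inv\<^sup>2 * comm (Ymat S q) (map_matrix euler (Ymat S q)) $ i $ j)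
      - lift (cst (1 / (8 * \<gamma>))) * comm (Ematrix P Q) (Ematrix ?P' ?Q') $ i $ j
      + lift (cst (1 / (8 * \<gamma>)) * lam_inv\<^sup>2) * comm (Ematrix ?R ?T) (Ematrix ?R' ?T') $ i $ j" for i j
    unfolding spectral_S_def Pplus_conv Pminus_conv map_euler_ext_Ematrix
    by (simp add: P_def Q_def \<tau>_def)
  show ?thesis
    unfolding vec_eq_iff 1 * mult_2
    unfolding comm_Ematrix_nth
    by (simp add: lift_simps lift_2 algebra_simps)
qed

section \<open>Cancellation of exp (\<lambda> p) and of the root of b c\<close>

section \<open>Eliminating the exponential of the potential\<close>

text \<open>This is exp (c \<lambda> p). The inner series has zero constant term, so the composition
  respects products.\<close>

definition exp_lam :: "complex \<Rightarrow> complex fps \<Rightarrow> complex fls" where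
  "exp_lam c p = fps_to_fls (fps_compose (fps_exp c) (fps_X * p))"

lemma cosh_lam_conv: "cosh_lam p = cst (1/2) * (exp_lam 1 p + exp_lam (- 1) p)"
  by (simp add: cosh_lam_def exp_lam_def fps_compose_mult_distrib fps_compose_add_distrib
      fls_times_fps_to_fls)

lemma sinh_lam_conv: "sinh_lam p = cst (1/2) * (exp_lam 1 p - exp_lam (- 1) p)"
  by (simp add: sinh_lam_def exp_lam_def fps_compose_mult_distrib fps_compose_sub_distrib
      fls_times_fps_to_fls)

lemma exp_lam_mult: "exp_lam 1 p * exp_lam (- 1) p = 1"
  by (simp add: exp_lam_def fps_compose_mult_distrib[symmetric] fps_exp_add_mult[symmetric]
      flip: fls_times_fps_to_fls)

lemma euler_exp_lam: "euler (exp_lam c p) = cst c * exp_lam c p * euler (lam * fps_to_fls p)"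
proof -
  have "fls_deriv (exp_lam c p) =
      fps_to_fls (fps_deriv (fps_exp c oo (fps_X * p)))"
    by (simp add: exp_lam_def fls_deriv_fps_to_fls)
  also have "fps_deriv (fps_exp c oo (fps_X * p)) = fps_const c * (fps_exp c oo (fps_X * p)) * fps_deriv (fps_X * p)"
    by (simp add: fps_compose_deriv fps_compose_mult_distrib)
  also have "fps_to_fls \<dots> = cst c * exp_lam c p * fps_to_fls (fps_deriv (fps_X * p))"
    by (simp only: exp_lam_def fls_times_fps_to_fls fps_const_to_fls)
  also have "fps_to_fls (fps_deriv (fps_X * p)) = fls_deriv (lam * fps_to_fls p)"
    by (simp only: fls_deriv_fps_to_fls[symmetric] fls_times_fps_to_fls fps_X_to_fls)
  finally show ?thesis by (simp add: euler_def algebra_simps)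
qed

text \<open>The field identities behind the reduction, with \<open>L\<close> = \<lambda>,
  \<open>l\<close> = 1/\<lambda>, \<open>G\<close> = \<gamma> and \<open>g\<close> its root. Primes
  are Euler derivatives: l' = - l accounts for the subtracted products in \<open>R'\<close> and
  \<open>T'\<close>, and \<open>quadric'\<close> is half the derivative of \<open>quadric\<close>.
  Since [R, T] is a multiple of Y, the derivatives of the scalar factors in front of
  \<open>R\<close> and \<open>T\<close> can contribute only a multiple of Y.\<close>

lemma frame_commutators:
  fixes a b c a' b' c' L l i G g :: "'a::field_char_0"
  assumes nz: "b \<noteq> 0" "c \<noteq> 0" "L \<noteq> 0" "G \<noteq> 0"
    and i: "i * i = -1" and g: "g * g = G" and l: "l * L = 1"
    and quadric: "a * a = 4 * b * c - 4 * G * L * L"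
    and quadric': "a * a' = 2 * (b' * c + b * c') - 4 * G * L * L"
  defines "Y \<equiv> mat22 (- i * a) (2 * c) (2 * b) (i * a)"
    and "Y' \<equiv> mat22 (- i * a') (2 * c') (2 * b') (i * a')"
    and "R \<equiv> mat22 (l * b * c) (g * c + i * l * a * c / 2) (- g * b + i * l * a * b / 2) (- (l * b * c))"
    and "R' \<equiv> mat22 (l * (b' * c + b * c' - b * c))
      (g * c' + i * l * (a' * c + a * c' - a * c) / 2)
      (- g * b' + i * l * (a' * b + a * b' - a * b) / 2) (- (l * (b' * c + b * c' - b * c)))"
    and "T \<equiv> mat22 (- (l * b * c)) (g * c - i * l * a * c / 2) (- g * b - i * l * a * b / 2) (l * b * c)"
    and "T' \<equiv> mat22 (- (l * (b' * c + b * c' - b * c)))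
      (g * c' - i * l * (a' * c + a * c' - a * c) / 2)
      (- g * b' - i * l * (a' * b + a * b' - a * b) / 2) (l * (b' * c + b * c' - b * c))"
  shows "msc (1 / (32 * G) * l\<^sup>2) (comm Y Y')
       - msc (2 * (1 / (8 * G))) (msc (1 / (4 * (b * c))) (comm R T' + comm T R')) =
     mat22 ((c * b' - b * c') / (4 * (b * c))) (i * (a' - a) / (4 * b))
           (- (i * (a' - a) / (4 * c))) (- ((c * b' - b * c') / (4 * (b * c))))"
    and "comm R T = msc (2 * g * l * b * c) Y"
proof -
  have inv: "l = 1 / L"
    using nz(3) l by (simp add: field_simps)
  show "msc (1 / (32 * G) * l\<^sup>2) (comm Y Y')
       - msc (2 * (1 / (8 * G))) (msc (1 / (4 * (b * c))) (comm R T' + comm T R')) =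
     mat22 ((c * b' - b * c') / (4 * (b * c))) (i * (a' - a) / (4 * b))
           (- (i * (a' - a) / (4 * c))) (- ((c * b' - b * c') / (4 * (b * c))))"
    unfolding Y_def Y'_def R_def R'_def T_def T'_def inv using nz i g quadric quadric'
    by (intro eq22I; simp add: comm_nth divide_simps power2_eq_square; algebra)
  show "comm R T = msc (2 * g * l * b * c) Y"
    unfolding Y_def R_def T_def
    by (intro eq22I; simp add: comm_nth field_simps)
qed

lemma cst_mult: "cst (x * y) = cst x * cst y"
  by (simp add: fls_const_mult_const)

lemma cst_numeral: "cst (numeral k) = numeral k"
  by simp

lemma cst_one_over: "cst (1 / x) = 1 / cst x"
proof (cases "x = 0")
  case False
  then have "cst (1 / x) * cst x = 1" by (simp flip: cst_mult)
  then show ?thesis using False by (simp add: field_simps)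
qed simp

lemma cst_ii: "cst \<i> * cst \<i> = - 1"
  by (simp flip: cst_mult)

lemma cst_ii_left: "cst \<i> * (cst \<i> * f) = - f"
  by (simp add: cst_ii flip: mult.assoc)

text \<open>The explicit form of S; the terms in \<open>w\<close> together are w Y.\<close>

definition reduced_S :: "complex fls \<Rightarrow> complex fls \<Rightarrow> complex fls \<Rightarrow> complex fls \<Rightarrow> lmat" where
  "reduced_S a b c w = mat22
     ((c * euler b - b * euler c) / (4 * (b * c)) - cst \<i> * w * a)
     (cst \<i> * (euler a - a) / (4 * b) + 2 * w * c)
     (- (cst \<i> * (euler a - a) / (4 * c)) + 2 * w * b)
     (- ((c * euler b - b * euler c) / (4 * (b * c))) + cst \<i> * w * a)"

text \<open>\<open>frame_pos\<close> and \<open>frame_neg\<close> are what is left of the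
  coefficients of E and E^-1 in P_+ when the scalars exp (\<lambda> p) / (2 r) and exp (- \<lambda>
  p) / (2 r) are taken out.\<close>

definition frame_pos :: "complex \<Rightarrow> complex fls \<Rightarrow> complex fls \<Rightarrow> complex fls \<Rightarrow> lmat" where
  "frame_pos sg a b c = mat22 (lam_inv * b * c) (cst sg * c + cst \<i> * lam_inv * a * c / 2)
     (- cst sg * b + cst \<i> * lam_inv * a * b / 2) (- (lam_inv * b * c))"

definition frame_neg :: "complex \<Rightarrow> complex fls \<Rightarrow> complex fls \<Rightarrow> complex fls \<Rightarrow> lmat" where
  "frame_neg sg a b c = mat22 (- (lam_inv * b * c)) (cst sg * c - cst \<i> * lam_inv * a * c / 2)
     (- cst sg * b - cst \<i> * lam_inv * a * b / 2) (lam_inv * b * c)"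

lemma euler_half: "euler (f / 2) = euler f / 2"
proof -
  have "2 * euler (f / 2) = euler (2 * (f / 2))" by (simp only: euler_mult euler_numeral) simp
  then show ?thesis by (simp add: mult.commute)
qed

lemmas euler_simps = euler_add euler_diff euler_uminus euler_mult euler_lam euler_lam_inv euler_half

lemma euler_quadric:
  assumes "a * a = 4 * b * c - 4 * cst \<gamma> * lam * lam"
  shows "a * euler a = 2 * (euler b * c + b * euler c) - 4 * cst \<gamma> * lam * lam"
proof -
  have "euler (a * a) = euler (4 * b * c - 4 * cst \<gamma> * lam * lam)"
    by (simp only: assms)
  then have "2 * (a * euler a) = 2 * (2 * (euler b * c + b * euler c) - 4 * cst \<gamma> * lam * lam)"
    by (simp add: euler_simps algebra_simps)
  then show ?thesis
    by (simp only: mult_cancel_left) simp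
qed

lemma exp_lam_conv:
  "exp_lam 1 p = cosh_lam p + sinh_lam p" "exp_lam (- 1) p = cosh_lam p - sinh_lam p"
  by (simp_all add: cosh_lam_conv sinh_lam_conv cst_one_over field_simps)

lemma
  fixes sg S r p q
  defines "a \<equiv> bold_a S q" and "b \<equiv> bold_b S q" and "c \<equiv> bold_c S q"
  shows E_coeff_conv: "E_coeff (Vplus sg S r p q) (Vminus sg S r p q) =
      msc (exp_lam 1 (p q) * inverse (2 * r q)) (frame_pos sg a b c)"
    and E_inv_coeff_conv: "E_inv_coeff (Vplus sg S r p q) (Vminus sg S r p q) =
      msc (exp_lam (- 1) (p q) * inverse (2 * r q)) (frame_neg sg a b c)"
proof -
  define s where "s = inverse (2 * r q)"
  have half: "2 * (cst (1/2) * f) = f" "2 * (f / 2) = f" for f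
    by (simp_all add: cst_one_over)
  have s: "1 / (2 * r q) = s"
    by (simp only: s_def divide_inverse mult_1_left)
  \<comment> \<open>Both sides are compared after doubling, which removes the halves coming from
    cosh and sinh.\<close>
  have twice: "A = B" if "msc 2 A = msc 2 B" for A B :: lmat
    using that by (simp add: vec_eq_iff)
  have 1: "msc 2 (E_coeff (Vplus sg S r p q) (Vminus sg S r p q)) =
     Vplus sg S r p q - msc lam_inv (Vminus sg S r p q)"
     and 2: "msc 2 (E_inv_coeff (Vplus sg S r p q) (Vminus sg S r p q)) =
     Vplus sg S r p q + msc lam_inv (Vminus sg S r p q)"
     by (simp_all add: vec_eq_iff E_coeff_def E_inv_coeff_def half)
  have 3: "msc 2 (frame_pos sg a b c) = mat22 (2 * lam_inv * b * c) (2 * cst sg * c + cst \<i> * lam_inv * a * c)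
     (- 2 * cst sg * b + cst \<i> * lam_inv * a * b) (- (2 * lam_inv * b * c))"
     and 4: "msc 2 (frame_neg sg a b c) = mat22 (- (2 * lam_inv * b * c)) (2 * cst sg * c - cst \<i> * lam_inv * a * c)
     (- 2 * cst sg * b - cst \<i> * lam_inv * a * b) (2 * lam_inv * b * c)"
     by (intro eq22I; simp add: frame_pos_def frame_neg_def distrib_left right_diff_distrib half)+
  have 5: "msc 2 (msc x A) = msc x (msc 2 A)" for x and A :: lmat
    by (simp add: vec_eq_iff)
  show "E_coeff (Vplus sg S r p q) (Vminus sg S r p q) = msc (exp_lam 1 (p q) * inverse (2 * r q)) (frame_pos sg a b c)"
    unfolding s_def[symmetric]
    apply (rule twice)
    unfolding 1 5 3
    by (rule eq22I; simp add: Vplus_def Vminus_def Let_def exp_lam_conv s flip: a_def b_def c_def; simp add: algebra_simps lam_cancel)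
  show "E_inv_coeff (Vplus sg S r p q) (Vminus sg S r p q) = msc (exp_lam (- 1) (p q) * inverse (2 * r q)) (frame_neg sg a b c)"
    unfolding s_def[symmetric]
    apply (rule twice)
    unfolding 2 5 4
    by (rule eq22I; simp add: Vplus_def Vminus_def Let_def exp_lam_conv s flip: a_def b_def c_def; simp add: algebra_simps lam_cancel)
qed

text \<open>The product rule: differentiating the scalars gives s t' [R, T] + t s' [T, R], and the
  two \<tau> terms agree because [T, R] = - [R, T].\<close>

lemma comm_msc_euler:
  fixes s t \<tau> :: "complex fls" and R T :: lmat
  defines "P \<equiv> msc s R" and "Q \<equiv> msc t T"
  shows "comm P (map_matrix euler Q - msc \<tau> Q) + comm Q (map_matrix euler P + msc \<tau> P) =
    msc (s * t) (comm R (map_matrix euler T) + comm T (map_matrix euler R))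
    + msc (s * euler t - t * euler s - 2 * \<tau> * s * t) (comm R T)"
  unfolding P_def Q_def
  by (simp add: vec_eq_iff comm_nth euler_mult algebra_simps)

lemma spectral_S_reduced:
  fixes N \<gamma> sg S r p q
  defines "a \<equiv> bold_a S q" and "b \<equiv> bold_b S q" and "c \<equiv> bold_c S q"
    and "u \<equiv> tfrak N S q + fps_to_fls (p q) / (4 * cst sg)"
  assumes "\<gamma> \<noteq> 0" "sg\<^sup>2 = \<gamma>" "(r q)\<^sup>2 = b * c" "b \<noteq> 0" "c \<noteq> 0"
    and quadric: "a * a - 4 * b * c = - 4 * cst \<gamma> * lam * lam"
  shows "spectral_S N \<gamma> sg S r p q = map_matrix lift (reduced_S a b c (u + euler u))"
proof -
  define \<tau> where "\<tau> = cst (4 * sg) * euler (lam * tfrak N S q)"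
  let ?s = "exp_lam 1 (p q) * inverse (2 * r q)" and ?t = "exp_lam (- 1) (p q) * inverse (2 * r q)"
  let ?R = "frame_pos sg a b c" and ?T = "frame_neg sg a b c"
  have sg: "sg \<noteq> 0" "cst sg * cst sg = cst \<gamma>" "cst sg \<noteq> 0" "cst \<gamma> \<noteq> 0"
    using assms(5,6) by (auto simp: power2_eq_square simp flip: cst_mult)
  have r: "r q \<noteq> 0" using assms(7,8,9) by auto
  have quadric1: "a * a = 4 * b * c - 4 * cst \<gamma> * lam * lam"
    using quadric by (simp add: algebra_simps)
  note quadric2 = euler_quadric[OF quadric1]
  have exp: "exp_lam 1 (p q) * exp_lam (- 1) (p q) = 1"
    by (rule exp_lam_mult)
  have st: "?s * ?t = 1 / (4 * (b * c))"
  proof -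
    have "?s * ?t = (exp_lam 1 (p q) * exp_lam (- 1) (p q)) * inverse (4 * (r q)\<^sup>2)"
      by (simp add: power2_eq_square field_simps)
    then show ?thesis by (simp only: exp assms(7) divide_inverse mult_1_left)
  qed
  \<comment> \<open>The common factor \<open>h\<close>, later 1/(2 r), is differentiated
    symmetrically in both terms, so its derivative drops out and no derivative of the root
    remains.\<close>
  have "exp_lam 1 (p q) * h * euler (exp_lam (- 1) (p q) * h)
      - exp_lam (- 1) (p q) * h * euler (exp_lam 1 (p q) * h)
      = - 2 * euler (lam * fps_to_fls (p q)) * (exp_lam 1 (p q) * h * (exp_lam (- 1) (p q) * h))" for h
    unfolding euler_mult[of _ h] euler_exp_lam by (simp add: algebra_simps)
  then have st': "?s * euler ?t - ?t * euler ?s = - 2 * euler (lam * fps_to_fls (p q)) * (?s * ?t)" .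
  \<comment> \<open>Both terms on the left are Euler derivatives of multiples of \<lambda>; together
    they give that of 4 sg \<lambda> u, and (\<lambda> u)' = \<lambda> (u + u').\<close>
  have w: "euler (lam * fps_to_fls (p q)) + \<tau> = 4 * cst sg * lam * (u + euler u)"
  proof -
    have "4 * cst sg * u = 4 * cst sg * tfrak N S q + fps_to_fls (p q)"
      using sg by (simp add: u_def field_simps)
    moreover from arg_cong[OF this, of euler]
    have "4 * cst sg * euler u = 4 * cst sg * euler (tfrak N S q) + euler (fps_to_fls (p q))"
      by (simp add: euler_simps)
    ultimately have "lam * (4 * cst sg * u + 4 * cst sg * euler u) =
        lam * (4 * cst sg * tfrak N S q + fps_to_fls (p q)
          + (4 * cst sg * euler (tfrak N S q) + euler (fps_to_fls (p q))))"
      by simp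
    then show ?thesis
      by (simp add: \<tau>_def euler_simps cst_mult cst_numeral algebra_simps)
  qed
  note frame = frame_commutators[OF assms(8,9) _ sg(4) cst_ii sg(2) _ quadric1 quadric2,
      where l = lam_inv]
  have eY: "Ymat S q = mat22 (- cst \<i> * a) (2 * c) (2 * b) (cst \<i> * a)"
    by (simp add: Ymat_def a_def b_def c_def)
  have eY': "map_matrix euler (Ymat S q) = mat22 (- cst \<i> * euler a) (2 * euler c) (2 * euler b) (cst \<i> * euler a)"
    by (intro eq22I; simp add: eY euler_simps)
  have eR: "map_matrix euler ?R = mat22 (lam_inv * (euler b * c + b * euler c - b * c))
      (cst sg * euler c + cst \<i> * lam_inv * (euler a * c + a * euler c - a * c) / 2)
      (- cst sg * euler b + cst \<i> * lam_inv * (euler a * b + a * euler b - a * b) / 2)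
      (- (lam_inv * (euler b * c + b * euler c - b * c)))"
    by (intro eq22I; simp add: frame_pos_def euler_simps; simp add: algebra_simps)
  have eT: "map_matrix euler ?T = mat22 (- (lam_inv * (euler b * c + b * euler c - b * c)))
      (cst sg * euler c - cst \<i> * lam_inv * (euler a * c + a * euler c - a * c) / 2)
      (- cst sg * euler b - cst \<i> * lam_inv * (euler a * b + a * euler b - a * b) / 2)
      (lam_inv * (euler b * c + b * euler c - b * c))"
    by (intro eq22I; simp add: frame_neg_def euler_simps; simp add: algebra_simps)
  have main: "msc (1 / (32 * cst \<gamma>) * lam_inv\<^sup>2) (comm (Ymat S q) (map_matrix euler (Ymat S q)))
     - msc (2 * (1 / (8 * cst \<gamma>))) (msc (1 / (4 * (b * c)))
        (comm ?R (map_matrix euler ?T) + comm ?T (map_matrix euler ?R))) =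
     mat22 ((c * euler b - b * euler c) / (4 * (b * c))) (cst \<i> * (euler a - a) / (4 * b))
           (- (cst \<i> * (euler a - a) / (4 * c))) (- ((c * euler b - b * euler c) / (4 * (b * c))))"
    unfolding eY' eR eT unfolding eY frame_pos_def frame_neg_def
    by (rule frame(1)) (simp_all add: lam_lam_inv mult.commute[of lam_inv])
  have RT: "comm ?R ?T = msc (2 * cst sg * lam_inv * b * c) (Ymat S q)"
    unfolding eY frame_pos_def frame_neg_def
    by (rule frame(2)) (simp_all add: lam_lam_inv mult.commute[of lam_inv])
  define w where "w = u + euler u"
  \<comment> \<open>The total factor of Y. The factor b c of [R, T] cancels the denominator of s t,
    and \<gamma> = sg^2 and \<lambda> \<lambda>^-1 = 1 remove the rest.\<close>
  have coeff: "- (2 * (1 / (8 * cst \<gamma>)) * ((?s * euler ?t - ?t * euler ?s - 2 * \<tau> * ?s * ?t)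
      * (2 * cst sg * lam_inv * b * c))) = w"
  proof -
    have "?s * euler ?t - ?t * euler ?s - 2 * \<tau> * ?s * ?t
        = - 2 * (euler (lam * fps_to_fls (p q)) + \<tau>) * (?s * ?t)"
      unfolding st' by (simp add: algebra_simps)
    also have "\<dots> = - 2 * (cst sg * lam * w) / (b * c)"
      unfolding st w w_def by simp
    finally have eq: "?s * euler ?t - ?t * euler ?s - 2 * \<tau> * ?s * ?t = - 2 * (cst sg * lam * w) / (b * c)" .
    have "- (2 * (1 / (8 * (x * x))) * (- 2 * (x * L * w) / (b * c) * (2 * x * l * b * c))) = L * l * w"
      if "x \<noteq> 0" for x L l
      using that assms(8,9) by (simp add: field_simps)
    from this[OF sg(3)] show ?thesis
      unfolding eq sg(2)[symmetric] by (simp only: lam_lam_inv mult_1_left)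
  qed
  have "spectral_S N \<gamma> sg S r p q = map_matrix lift
     (msc (1 / (32 * cst \<gamma>) * lam_inv\<^sup>2) (comm (Ymat S q) (map_matrix euler (Ymat S q)))
      - msc (2 * (1 / (8 * cst \<gamma>))) (msc (?s * ?t)
          (comm ?R (map_matrix euler ?T) + comm ?T (map_matrix euler ?R))
        + msc (?s * euler ?t - ?t * euler ?s - 2 * \<tau> * ?s * ?t) (comm ?R ?T)))"
    unfolding spectral_S_conv E_coeff_conv E_inv_coeff_conv comm_msc_euler
    by (simp only: \<tau>_def a_def[symmetric] b_def[symmetric] c_def[symmetric]
        cst_one_over cst_mult cst_numeral)
  also have "\<dots> = map_matrix lift ((msc (1 / (32 * cst \<gamma>) * lam_inv\<^sup>2)
        (comm (Ymat S q) (map_matrix euler (Ymat S q)))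
      - msc (2 * (1 / (8 * cst \<gamma>))) (msc (1 / (4 * (b * c)))
          (comm ?R (map_matrix euler ?T) + comm ?T (map_matrix euler ?R))))
      + msc w (Ymat S q))"
    unfolding st RT coeff[symmetric]
    by (intro arg_cong[of _ _ "map_matrix lift"]) (simp add: vec_eq_iff algebra_simps)
  also have "\<dots> = map_matrix lift (reduced_S a b c w)"
    unfolding main unfolding eY
    by (intro arg_cong[of _ _ "map_matrix lift"] eq22I) (simp_all add: reduced_S_def algebra_simps)
  finally show ?thesis unfolding w_def .
qed

section \<open>The Killing equation\<close>

text \<open>
  Primes stand for the Euler operator, the prefix \<open>d\<close> for the derivative along a tangent vector
  \<open>v\<close>, \<open>m\<close> for \<open>1/(b c)\<close>, \<open>w\<close> for \<open>u + u'\<close>, and \<open>x\<close>, \<open>y\<close>, \<open>z\<close> for the entries 11, 12, 21 of \<open>\<phi> v\<close>.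
\<close>

lemma killing_algebra:
  fixes a b c a' b' c' L i G w x y z x' y' z' :: "'a::field_char_0"
  assumes nz: "b \<noteq> 0" "c \<noteq> 0" and i: "i * i = -1"
    and quadric: "a * a = 4 * b * c - 4 * G * L * L"
    and quadric': "a * a' = 2 * (b' * c + b * c') - 4 * G * L * L"
  defines "F \<equiv> mat22 ((c * b' - b * c') / (4 * (b * c)) - i * w * a) (i * (a' - a) / (4 * b) + 2 * w * c)
     (- (i * (a' - a) / (4 * c)) + 2 * w * b) (- ((c * b' - b * c') / (4 * (b * c))) + i * w * a)"
    and "da \<equiv> 2 * i * (c * z - b * y)" and "db \<equiv> 2 * b * x + i * a * z" and "dc \<equiv> - 2 * c * x - i * a * y"
    and "da' \<equiv> 2 * i * (c' * z + c * z' - (b' * y + b * y'))"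
    and "db' \<equiv> 2 * (b' * x + b * x') + i * (a' * z + a * z')"
    and "dc' \<equiv> - 2 * (c' * x + c * x') - i * (a' * y + a * y')"
    and "dm \<equiv> - (i * a * (c * z - b * y)) / (b * c)^2"
    and "dw \<equiv> (b * y + c * z) / (4 * (b * c)) + ((b' * y + b * y' + (c' * z + c * z')) * (b * c)
           - (b * y + c * z) * (b' * c + b * c')) / (4 * (b * c)^2)"
  defines "dF11 \<equiv> ((dc * b' + c * db' - (db * c' + b * dc')) / (b * c) + (c * b' - b * c') * dm) / 4 - i * (dw * a + w * da)"
   and "dF12 \<equiv> i * ((da' - da) * c / (b * c) + (a' - a) * (dc / (b * c) + c * dm)) / 4 + 2 * (dw * c + w * dc)"
   and "dF21 \<equiv> - (i * ((da' - da) * b / (b * c) + (a' - a) * (db / (b * c) + b * dm)) / 4) + 2 * (dw * b + w * db)"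
  shows "mat22 dF11 dF12 dF21 (- dF11) + comm (mat22 x y z (- x)) F = mat22 x' y' z' (- x')"
proof -
  \<comment> \<open>Clearing denominators leaves polynomial identities modulo i^2 = -1 and, off the
    diagonal, modulo the quadric and its Euler derivative.\<close>
  have 1: "dF11 + comm (mat22 x y z (- x)) F $ 1 $ 1 = x'"
    unfolding F_def da_def db_def dc_def da'_def db'_def dc'_def dm_def dw_def dF11_def dF12_def dF21_def
    using nz i
    apply (simp add: comm_nth divide_simps power2_eq_square)
    apply algebra
    done
  have 2: "dF12 + comm (mat22 x y z (- x)) F $ 1 $ 2 = y'"
    unfolding F_def da_def db_def dc_def da'_def db'_def dc'_def dm_def dw_def dF11_def dF12_def dF21_def
    using nz i quadric quadric'
    apply (simp add: comm_nth divide_simps power2_eq_square)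
    apply algebra
    done
  have 3: "dF21 + comm (mat22 x y z (- x)) F $ 2 $ 1 = z'"
    unfolding F_def da_def db_def dc_def da'_def db'_def dc'_def dm_def dw_def dF11_def dF12_def dF21_def
    using nz i quadric quadric'
    apply (simp add: comm_nth divide_simps power2_eq_square)
    apply algebra
    done
  have 4: "comm (mat22 x y z (- x)) F $ 2 $ 2 = - comm (mat22 x y z (- x)) F $ 1 $ 1"
    by (simp add: comm_nth)
  show ?thesis
    using 1 2 3 by (intro eq22I) (simp_all add: 4 algebra_simps)
qed

section \<open>The connection form is trace-free\<close>

text \<open>Reflecting a principal part gives a sequence that vanishes at negative indices, so here
  \<open>Abs_fls\<close> does return the reflected coefficients.\<close>

lemma fls_bar_prpart_uminus:
  "fls_bar (fls_prpart_as_fls (- f)) = - fls_bar (fls_prpart_as_fls f)"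
proof -
  have "fls_nth (fls_bar (fls_prpart_as_fls g)) n = cnj (fls_nth (fls_prpart_as_fls g) (- n))" for g n
    unfolding fls_bar_def
    by (rule nth_Abs_fls_lower_bound[of 0]) (simp only: fls_prpart_as_fls_nth, simp)
  then show ?thesis
    by (intro fls_eqI) (simp only: fls_prpart_as_fls_nth fls_uminus_nth, simp)
qed

text \<open>Y is trace-free, and sign changes commute with principal parts and with the bar. Hence
  three entries of \<phi> suffice in the Killing equation.\<close>

lemma phi_22: "phi N S q v $ 2 $ 2 = - phi N S q v $ 1 $ 1"
proof -
  have "msc k (Ymat S q) $ 2 $ 2 = - msc k (Ymat S q) $ 1 $ 1" for k
    by (simp add: Ymat_def)
  then have U: "Umat S m q $ 2 $ 2 = fls_prpart_as_fls (- (msc (cst (1 / (2 * \<i>)) * lam_inv ^ (2 * m + 2)) (Ymat S q) $ 1 $ 1))"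
    "Umat S m q $ 1 $ 1 = fls_prpart_as_fls (msc (cst (1 / (2 * \<i>)) * lam_inv ^ (2 * m + 2)) (Ymat S q) $ 1 $ 1)" for m
    unfolding Umat_def map_matrix_nth by simp_all
  have "Umat S m q $ 2 $ 2 = - Umat S m q $ 1 $ 1" for m
    unfolding U by (rule fls_eqI) (simp only: fls_prpart_as_fls_nth fls_uminus_nth, simp)
  moreover have "bar_transpose (Umat S m q) $ 2 $ 2 = - bar_transpose (Umat S m q) $ 1 $ 1" for m
    unfolding bar_transpose_def by (simp only: transpose_def vec_lambda_beta map_matrix_nth U fls_bar_prpart_uminus)
  ultimately show ?thesis
    by (simp add: phi_def sum_negf)
qed

lemma fls_nth_bold [simp]:
  "fls_nth (bold_a S q) n = (if 0 \<le> n \<and> even n then acoef S (nat n + 1) q else 0)"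
  "fls_nth (bold_b S q) n = (if 0 \<le> n \<and> odd n then bcoef S (nat n + 1) q else 0)"
  "fls_nth (bold_c S q) n = (if 0 \<le> n \<and> odd n then ccoef S (nat n + 1) q else 0)"
  by (auto simp: bold_a_def bold_b_def bold_c_def even_nat_iff)

lemma det_mat22: "det (mat22 x y z w) = x * w - y * z" for x :: "'a::comm_ring_1"
  by (simp add: det_2)

section \<open>The series a, b, c, 1/(b c) and the potential u of a given solution\<close>

context
  fixes \<A> :: "('m::{t2_space, second_countable_topology}, 'e::euclidean_space) atlas"
    and N :: nat and \<gamma> sg :: complex and S :: "'m cmc_data" and p :: "'m \<Rightarrow> complex fps"
  assumes \<gamma>: "\<gamma> \<noteq> 0" and sg: "sg\<^sup>2 = \<gamma>"
    and sol: "truncated_cmc_solution \<A> N \<gamma> S"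
    and p_smooth: "smooth_fls \<A> (\<lambda>q. fps_to_fls (p q))"
    and p_even: "\<And>q k. odd k \<Longrightarrow> fps_nth (p q) k = 0"
    and dp: "\<And>q v. v \<in> tangent_space \<A> q \<Longrightarrow>
           dfls v (\<lambda>x. fps_to_fls (p x)) =
             cst sg * (bold_b S q * phi_check N S q v $ 1 $ 2
                       + bold_c S q * phi_check N S q v $ 2 $ 1)
               / (bold_b S q * bold_c S q)"
begin

lemma atlas: "smooth_atlas \<A>"
  using sol by (simp add: truncated_cmc_solution_def)

lemma bold_smooth: "smooth_fls \<A> (bold_a S)" "smooth_fls \<A> (bold_b S)" "smooth_fls \<A> (bold_c S)"
proof -
  have abc: "smooth_fun \<A> (acoef S (2 * n + 1))" "smooth_fun \<A> (bcoef S (2 * n + 2))"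
    "smooth_fun \<A> (ccoef S (2 * n + 2))" for n
    using sol unfolding truncated_cmc_solution_def by blast+
  have "smooth_fun \<A> (\<lambda>q. fps_nth (Abs_fps (\<lambda>k. if even k then acoef S (k + 1) q else 0)) n)" for n
    using abc(1)[of "n div 2"] by (cases "even n") (auto simp: smooth_fun_const)
  then show "smooth_fls \<A> (bold_a S)"
    unfolding bold_a_def[abs_def] by (rule smooth_fls_fps_to_fls)
  \<comment> \<open>Brings the superscript n + 1 into the form 2 k + 2 in which smoothness is
    given.\<close>
  have *: "n + 1 = 2 * (n div 2) + 2" if "odd n" for n :: nat
    using that by presburger
  have "smooth_fun \<A> (\<lambda>q. fps_nth (Abs_fps (\<lambda>k. if odd k then bcoef S (k + 1) q else 0)) n)" for n
    using abc(2)[of "n div 2"] *[of n] by (cases "odd n") (simp_all add: smooth_fun_const)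
  then show "smooth_fls \<A> (bold_b S)"
    unfolding bold_b_def[abs_def] by (rule smooth_fls_fps_to_fls)
  have "smooth_fun \<A> (\<lambda>q. fps_nth (Abs_fps (\<lambda>k. if odd k then ccoef S (k + 1) q else 0)) n)" for n
    using abc(3)[of "n div 2"] *[of n] by (cases "odd n") (simp_all add: smooth_fun_const)
  then show "smooth_fls \<A> (bold_c S)"
    unfolding bold_c_def[abs_def] by (rule smooth_fls_fps_to_fls)
qed

text \<open>Both series start at \<lambda>, and in b^2 c^2 the roots of h_2 cancel. The leading
  coefficient is thus the same at every point, as \<open>smooth_fls_inverse\<close>
  requires.\<close>

lemma bold_bc_nth:
  "n < 2 \<Longrightarrow> fls_nth (bold_b S q * bold_c S q) n = 0"
  "fls_nth (bold_b S q * bold_c S q) 2 = \<gamma>"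
proof -
  have odd_pos: "1 \<le> i" if "odd i" "0 \<le> i" for i :: int
    using that by presburger
  have nth: "fls_nth (bold_b S q * bold_c S q) n =
      (\<Sum>i=1..n - 1. fls_nth (bold_b S q) i * fls_nth (bold_c S q) (n - i))" for n
    by (rule fls_times_nth_bounds) (auto dest: odd_pos)
  show "fls_nth (bold_b S q * bold_c S q) n = 0" if "n < 2" for n
    using that by (simp only: nth) simp
  have bc: "bcoef S 2 q = - \<i> * \<gamma> / h2_root S q" "ccoef S 2 q = \<i> * h2_root S q"
    and h: "h2 S q \<noteq> 0" "(h2_root S q)\<^sup>2 = h2 S q"
    using sol unfolding truncated_cmc_solution_def by blast+
  then have "h2_root S q \<noteq> 0" by auto
  then show "fls_nth (bold_b S q * bold_c S q) 2 = \<gamma>"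
    by (simp only: nth) (simp add: bc numeral_2_eq_2[symmetric] mult.commute[of \<gamma>])
qed

lemma bold_nonzero: "bold_b S q * bold_c S q \<noteq> 0" "bold_b S q \<noteq> 0" "bold_c S q \<noteq> 0"
proof -
  show "bold_b S q * bold_c S q \<noteq> 0"
    using bold_bc_nth(2)[of q] \<gamma> by (metis fls_zero_nth)
  then show "bold_b S q \<noteq> 0" "bold_c S q \<noteq> 0" by auto
qed

lemma quadric: "bold_a S q * bold_a S q - 4 * bold_b S q * bold_c S q = - 4 * cst \<gamma> * lam * lam"
proof -
  have "det (Ymat S q) = cst (- 4 * \<gamma>) * lam\<^sup>2"
    using sol unfolding truncated_cmc_solution_def by blast
  moreover have "det (Ymat S q) = bold_a S q * bold_a S q - 4 * bold_b S q * bold_c S q"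
    unfolding Ymat_def det_mat22 by (simp add: cst_ii_left algebra_simps)
  moreover have "cst (- 4 * \<gamma>) = - (4 * cst \<gamma>)"
    by (simp only: cst_mult fls_const_uminus cst_numeral mult_minus_left)
  ultimately show ?thesis
    by (simp only: power2_eq_square mult.assoc mult_minus_left)
qed

text \<open>Only the product b c has a constant leading coefficient, so below 1/b and 1/c are
  expressed as c and b times this series.\<close>

definition inv_bc :: "'m \<Rightarrow> complex fls" where
  "inv_bc q = inverse (bold_b S q * bold_c S q)"

definition potential :: "'m \<Rightarrow> complex fls" where
  "potential q = tfrak N S q + fps_to_fls (p q) * inverse (4 * cst sg)"

lemma inv_bc_smooth: "smooth_fls \<A> inv_bc"
  unfolding inv_bc_def[abs_def]
  by (rule smooth_fls_inverse[OF atlas _ bold_bc_nth \<gamma>])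
    (rule smooth_fls_mult[OF atlas bold_smooth(2,3)])

lemma tfrak_smooth: "smooth_fls \<A> (tfrak N S)"
proof -
  have "smooth_fls \<A> (\<lambda>q. cst (tfun S m q))" if "m \<le> N" for m
  proof -
    have "smooth_fun \<A> (tfun S m)"
      using sol that unfolding truncated_cmc_solution_def by blast
    then have "smooth_fun \<A> (\<lambda>q. fps_nth (fps_const (tfun S m q)) n)" for n
      by (cases n) (simp_all add: smooth_fun_const)
    from smooth_fls_fps_to_fls[OF this] show ?thesis by simp
  qed
  then show ?thesis
    unfolding tfrak_def[abs_def]
    by (intro smooth_fls_mult smooth_fls_sum smooth_fls_const atlas) auto
qed

lemma potential_smooth: "smooth_fls \<A> potential"
  unfolding potential_def[abs_def]
  by (intro smooth_fls_add smooth_fls_mult tfrak_smooth p_smooth smooth_fls_const atlas)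

section \<open>The reduced field: smoothness, twist and Killing equation\<close>

definition killing_S :: "'m \<Rightarrow> lmat" where
  "killing_S q = reduced_S (bold_a S q) (bold_b S q) (bold_c S q) (potential q + euler (potential q))"

lemma quarter: "cst (1/4) = 1 / 4"
  by (simp add: cst_one_over)

text \<open>Divisions are replaced by products with constants and \<open>inv_bc\<close>, so that the
  rules for smoothness, parity and derivatives apply by structure alone.\<close>

lemma killing_S_nth:
  "killing_S q $ 1 $ 1 = cst (1/4) * ((bold_c S q * euler (bold_b S q) - bold_b S q * euler (bold_c S q)) * inv_bc q)
     - cst \<i> * ((potential q + euler (potential q)) * bold_a S q)"
  "killing_S q $ 1 $ 2 = cst \<i> * (cst (1/4) * ((euler (bold_a S q) - bold_a S q) * (bold_c S q * inv_bc q)))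
     + cst 2 * ((potential q + euler (potential q)) * bold_c S q)"
  "killing_S q $ 2 $ 1 = - (cst \<i> * (cst (1/4) * ((euler (bold_a S q) - bold_a S q) * (bold_b S q * inv_bc q))))
     + cst 2 * ((potential q + euler (potential q)) * bold_b S q)"
  "killing_S q $ 2 $ 2 = - (killing_S q $ 1 $ 1)"
  using bold_nonzero[of q]
  by (simp_all add: killing_S_def reduced_S_def inv_bc_def quarter field_simps)

lemma killing_S_smooth: "smooth_fls \<A> (\<lambda>q. killing_S q $ i $ j)"
proof -
  note rules = smooth_fls_add[OF atlas] smooth_fls_diff[OF atlas] smooth_fls_uminus[OF atlas]
    smooth_fls_mult[OF atlas] smooth_fls_euler[OF atlas] smooth_fls_const bold_smooth
    potential_smooth inv_bc_smooth
  have 11: "smooth_fls \<A> (\<lambda>q. killing_S q $ 1 $ 1)"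
    unfolding killing_S_nth by (intro rules)
  have 12: "smooth_fls \<A> (\<lambda>q. killing_S q $ 1 $ 2)"
    unfolding killing_S_nth by (intro rules)
  have 21: "smooth_fls \<A> (\<lambda>q. killing_S q $ 2 $ 1)"
    unfolding killing_S_nth by (intro rules)
  have 22: "smooth_fls \<A> (\<lambda>q. killing_S q $ 2 $ 2)"
    unfolding killing_S_nth(4) by (intro rules(3) 11)
  show ?thesis
    using 11 12 21 22 exhaust_2[of i] exhaust_2[of j] by (elim disjE) simp_all
qed

lemma bold_parity: "fls_parity True (bold_a S q)" "fls_parity False (bold_b S q)"
  "fls_parity False (bold_c S q)"
  by (simp_all add: fls_parity_def)

lemma inv_bc_parity: "fls_parity True (inv_bc q)"
  unfolding inv_bc_def
  using fls_parity_mult[OF bold_parity(2,3)] bold_bc_nth \<gamma>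
  by (intro fls_parity_inverse[where k = 2]) simp_all

lemmas even_mult = fls_parity_mult[of True _ True, simplified]
lemmas odd_mult = fls_parity_mult[of True _ False, simplified]
lemmas odd_odd_mult = fls_parity_mult[of False _ False, simplified]

lemma potential_parity: "fls_parity True (potential q)"
proof -
  have "fls_parity True (fps_to_fls (p q))"
    unfolding fls_parity_def
  proof (intro allI impI)
    fix n assume "fls_nth (fps_to_fls (p q)) n \<noteq> 0"
    then have "0 \<le> n" "fps_nth (p q) (nat n) \<noteq> 0" by (simp_all split: if_splits)
    with p_even[of "nat n" q] show "even n = True" by (auto simp: even_nat_iff)
  qed
  moreover have "fls_parity True (lam_inv ^ (2 * m + 2))" for m
    unfolding fls_parity_def fls_X_inv_power_nth by simp
  then have "fls_parity True (tfrak N S q)"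
    unfolding tfrak_def
    by (intro even_mult fls_parity_sum fls_parity_cst)
  moreover have "inverse (4 * cst sg) = cst (1 / (4 * sg))"
    by (simp only: cst_one_over cst_mult cst_numeral inverse_eq_divide)
  ultimately show ?thesis
    unfolding potential_def by (simp only:) (intro fls_parity_add even_mult fls_parity_cst)
qed

text \<open>a, u and 1/(b c) are even, b and c are odd, and the Euler operator preserves
  parity.\<close>

lemma killing_S_twisted: "killing_S q \<in> twisted_loop_algebra"
proof -
  have w: "fls_parity True (potential q + euler (potential q))"
    by (intro fls_parity_add fls_parity_euler potential_parity)
  have 11: "fls_parity True (killing_S q $ 1 $ 1)"
    unfolding killing_S_nth
    by (rule fls_parity_diff[OF even_mult[OF fls_parity_cst even_mult[OF fls_parity_diff[OF
            odd_odd_mult[OF bold_parity(3) fls_parity_euler[OF bold_parity(2)]]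
            odd_odd_mult[OF bold_parity(2) fls_parity_euler[OF bold_parity(3)]]] inv_bc_parity]]
          even_mult[OF fls_parity_cst even_mult[OF w bold_parity(1)]]])
  have da: "fls_parity True (euler (bold_a S q) - bold_a S q)"
    by (rule fls_parity_diff[OF fls_parity_euler[OF bold_parity(1)] bold_parity(1)])
  have mc: "fls_parity False (bold_c S q * inv_bc q)" "fls_parity False (bold_b S q * inv_bc q)"
    using odd_mult[OF inv_bc_parity] bold_parity(2,3) by (simp_all only: mult.commute[of _ "inv_bc q"])
  have 12: "fls_parity False (killing_S q $ 1 $ 2)"
    unfolding killing_S_nth
    by (rule fls_parity_add[OF odd_mult[OF fls_parity_cst odd_mult[OF fls_parity_cst odd_mult[OF da mc(1)]]]
          odd_mult[OF fls_parity_cst odd_mult[OF w bold_parity(3)]]])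
  have 21: "fls_parity False (killing_S q $ 2 $ 1)"
    unfolding killing_S_nth
    by (rule fls_parity_add[OF fls_parity_uminus[OF odd_mult[OF fls_parity_cst odd_mult[OF fls_parity_cst odd_mult[OF da mc(2)]]]]
          odd_mult[OF fls_parity_cst odd_mult[OF w bold_parity(2)]]])
  have 22: "fls_parity True (killing_S q $ 2 $ 2)"
    unfolding killing_S_nth(4) by (rule fls_parity_uminus[OF 11])
  have "trace (killing_S q) = 0"
    by (simp add: trace_def sum_2 killing_S_nth(4))
  moreover have "fls_parity (i = j) (killing_S q $ i $ j)" for i j
    using 11 12 21 22 exhaust_2[of i] exhaust_2[of j] by (elim disjE) simp_all
  ultimately show ?thesis
    unfolding twisted_loop_algebra_def fls_parity_def by simp
qed

text \<open>The structure equation for Y gives da, db, dc, and the equation for p gives du. Inserted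
  into the derivative of each entry, they turn the claim into
  \<open>killing_algebra\<close>.\<close>

lemma killing_S_equation:
  assumes v: "v \<in> tangent_space \<A> q"
  shows "dmat v killing_S + comm (phi N S q v) (killing_S q) = map_matrix euler (phi N S q v)"
proof -
  note smooth = smooth_fls_add[OF atlas] smooth_fls_diff[OF atlas] smooth_fls_uminus[OF atlas]
    smooth_fls_mult[OF atlas] smooth_fls_euler[OF atlas] smooth_fls_const[of \<A>] bold_smooth
    potential_smooth inv_bc_smooth
  note d_add = dfls_add[OF atlas v] and d_diff = dfls_diff[OF atlas v] and d_mult = dfls_mult[OF atlas v]
    and d_const = dfls_const[OF atlas v] and d_euler = dfls_euler[OF atlas v]
    and d_uminus = dfls_uminus[OF atlas v]
  define a b c where "a = bold_a S q" and "b = bold_b S q" and "c = bold_c S q"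
  define x y z where "x = phi N S q v $ 1 $ 1" and "y = phi N S q v $ 1 $ 2" and "z = phi N S q v $ 2 $ 1"
  have phi: "phi N S q v = mat22 x y z (- x)"
    by (intro eq22I) (simp_all add: x_def y_def z_def phi_22)
  have nz: "b \<noteq> 0" "c \<noteq> 0" using bold_nonzero by (simp_all add: b_def c_def)
  have sgnz: "cst sg \<noteq> 0" using sg \<gamma> by auto
  have quad: "a * a = 4 * b * c - 4 * cst \<gamma> * lam * lam"
    using quadric[of q] by (simp add: a_def b_def c_def algebra_simps)
  note quad' = euler_quadric[OF quad]
  have "dmat v (Ymat S) + comm (phi N S q v) (Ymat S q) = 0"
    using sol v unfolding truncated_cmc_solution_def by blast
  then have dY: "dfls v (\<lambda>q. Ymat S q $ i $ j) = - comm (phi N S q v) (Ymat S q) $ i $ j" for i j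
    unfolding vec_eq_iff dmat_def by (simp add: eq_neg_iff_add_eq_0)
  have da: "dfls v (bold_a S) = 2 * cst \<i> * (c * z - b * y)"
  proof -
    have "dfls v (\<lambda>q. cst \<i> * bold_a S q) = - comm (phi N S q v) (Ymat S q) $ 2 $ 2"
      using dY[of 2 2] by (simp add: Ymat_def)
    then have "cst \<i> * dfls v (bold_a S) = 2 * (b * y - c * z)"
      by (simp add: d_mult smooth d_const phi comm_nth Ymat_def a_def b_def c_def algebra_simps)
    then have "cst \<i> * (cst \<i> * dfls v (bold_a S)) = cst \<i> * (2 * (b * y - c * z))"
      by (simp only:)
    then have "dfls v (bold_a S) = - (cst \<i> * (2 * (b * y - c * z)))"
      by (metis cst_ii_left minus_minus)
    then show ?thesis by (simp add: algebra_simps)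
  qed
  have db: "dfls v (bold_b S) = 2 * b * x + cst \<i> * a * z"
  proof -
    have "dfls v (\<lambda>q. cst 2 * bold_b S q) = - comm (phi N S q v) (Ymat S q) $ 2 $ 1"
      using dY[of 2 1] by (simp add: Ymat_def)
    then have "2 * dfls v (bold_b S) = 2 * (2 * b * x + cst \<i> * a * z)"
      unfolding d_mult[OF smooth(6,8)] d_const
      by (simp add: phi comm_nth Ymat_def a_def b_def c_def algebra_simps)
    then show ?thesis by (simp only: mult_cancel_left) simp
  qed
  have dc: "dfls v (bold_c S) = - 2 * c * x - cst \<i> * a * y"
  proof -
    have "dfls v (\<lambda>q. cst 2 * bold_c S q) = - comm (phi N S q v) (Ymat S q) $ 1 $ 2"
      using dY[of 1 2] by (simp add: Ymat_def)
    then have "2 * dfls v (bold_c S) = 2 * (- 2 * c * x - cst \<i> * a * y)"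
      unfolding d_mult[OF smooth(6,9)] d_const
      by (simp add: phi comm_nth Ymat_def a_def b_def c_def algebra_simps)
    then show ?thesis by (simp only: mult_cancel_left) simp
  qed
  have "dfls v inv_bc = - dfls v (\<lambda>q. bold_b S q * bold_c S q) / (b * c)\<^sup>2"
    unfolding inv_bc_def[abs_def] b_def c_def
    using inv_bc_smooth unfolding inv_bc_def[abs_def]
    by (intro dfls_inverse[OF atlas v] smooth bold_nonzero(1))
  also have "dfls v (\<lambda>q. bold_b S q * bold_c S q) = cst \<i> * a * (c * z - b * y)"
    by (simp add: d_mult smooth db dc flip: b_def c_def; simp add: algebra_simps)
  finally have dm: "dfls v inv_bc = - (cst \<i> * a * (c * z - b * y)) / (b * c)\<^sup>2" .
  \<comment> \<open>The entries 2 c and 2 b of Y put -4 \<alpha> b c into the numerator of dp, so p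
    / (4 sg) contributes - \<alpha>, which cancels dt.\<close>
  have du: "dfls v potential = (b * y + c * z) / (4 * (b * c))"
  proof -
    have "dfls v potential = alpha N S v + dfls v (\<lambda>q. fps_to_fls (p q)) * inverse (4 * cst sg)"
      unfolding potential_def[abs_def] alpha_def
      by (simp only: d_add d_mult d_const smooth tfrak_smooth p_smooth mult_zero_right add_0_left)
    also have "dfls v (\<lambda>q. fps_to_fls (p q)) =
        cst sg * (b * (y - alpha N S v * (2 * c)) + c * (z - alpha N S v * (2 * b))) / (b * c)"
      unfolding dp[OF v] by (simp add: phi_check_def Ymat_def y_def z_def b_def c_def)
    finally have "dfls v potential = alpha N S v + cst sg * (b * (y - alpha N S v * (2 * c))
        + c * (z - alpha N S v * (2 * b))) / (b * c) * inverse (4 * cst sg)" .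
    also have "\<dots> = (b * y + c * z) / (4 * (b * c))"
      using nz sgnz by (simp add: divide_simps; simp add: algebra_simps)
    finally show ?thesis .
  qed
  have edu: "euler (dfls v potential) = ((euler b * y + b * euler y + (euler c * z + c * euler z)) * (b * c)
           - (b * y + c * z) * (euler b * c + b * euler c)) / (4 * (b * c)\<^sup>2)"
  proof -
    \<comment> \<open>The quotient is differentiated by applying the Euler operator to 4 b c du = b
      y + c z and solving for (du)'.\<close>
    have "euler (4 * (b * c) * dfls v potential) = euler (b * y + c * z)"
      using nz by (simp add: du)
    then have "4 * (euler b * c + b * euler c) * dfls v potential + 4 * (b * c) * euler (dfls v potential)
        = euler b * y + b * euler y + (euler c * z + c * euler z)"
      by (simp add: euler_simps)
    moreover have "E = (R * (b * c) - n * m) / (4 * (b * c)\<^sup>2)"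
      if "4 * m * (n / (4 * (b * c))) + 4 * (b * c) * E = R" for E R m n
      using nz unfolding that[symmetric] by (simp add: field_simps power2_eq_square)
    ultimately show ?thesis
      unfolding du by blast
  qed
  let ?w = "potential q + euler (potential q)"
  note alg = killing_algebra[OF nz cst_ii quad quad', where x = x and y = y and z = z and w = ?w
      and x' = "euler x" and y' = "euler y" and z' = "euler z"]
  have inv: "inv_bc q = 1 / (b * c)"
    by (simp only: inv_bc_def b_def c_def divide_inverse mult_1_left)
  \<comment> \<open>As d commutes with the Euler operator, these are also the differentials of a',
    b' and c'.\<close>
  have eda: "euler (dfls v (bold_a S)) = 2 * cst \<i> * (euler c * z + c * euler z - (euler b * y + b * euler y))"
    by (simp add: da euler_simps)
  have edb: "euler (dfls v (bold_b S)) = 2 * (euler b * x + b * euler x) + cst \<i> * (euler a * z + a * euler z)"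
    by (simp add: db euler_simps algebra_simps)
  have edc: "euler (dfls v (bold_c S)) = - 2 * (euler c * x + c * euler x) - cst \<i> * (euler a * y + a * euler y)"
    by (simp add: dc euler_simps algebra_simps)
  note d_rules = d_add d_diff d_uminus d_mult d_const d_euler smooth
  have F11: "dfls v (\<lambda>q. killing_S q $ 1 $ 1) =
     cst (1/4) * ((dfls v (bold_c S) * euler b + c * euler (dfls v (bold_b S))
        - (dfls v (bold_b S) * euler c + b * euler (dfls v (bold_c S)))) * inv_bc q
        + (c * euler b - b * euler c) * dfls v inv_bc)
     - cst \<i> * ((dfls v potential + euler (dfls v potential)) * a + ?w * dfls v (bold_a S))"
    unfolding killing_S_nth by (simp add: d_rules a_def b_def c_def; simp add: algebra_simps)
  have F12: "dfls v (\<lambda>q. killing_S q $ 1 $ 2) =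
     cst \<i> * (cst (1/4) * ((euler (dfls v (bold_a S)) - dfls v (bold_a S)) * (c * inv_bc q)
       + (euler a - a) * (dfls v (bold_c S) * inv_bc q + c * dfls v inv_bc)))
     + 2 * ((dfls v potential + euler (dfls v potential)) * c + ?w * dfls v (bold_c S))"
    unfolding killing_S_nth by (simp add: d_rules a_def b_def c_def; simp add: algebra_simps)
  have F21: "dfls v (\<lambda>q. killing_S q $ 2 $ 1) =
     - (cst \<i> * (cst (1/4) * ((euler (dfls v (bold_a S)) - dfls v (bold_a S)) * (b * inv_bc q)
       + (euler a - a) * (dfls v (bold_b S) * inv_bc q + b * dfls v inv_bc))))
     + 2 * ((dfls v potential + euler (dfls v potential)) * b + ?w * dfls v (bold_b S))"
    unfolding killing_S_nth by (simp add: d_rules a_def b_def c_def; simp add: algebra_simps)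
  have F22: "dfls v (\<lambda>q. killing_S q $ 2 $ 2) = - dfls v (\<lambda>q. killing_S q $ 1 $ 1)"
    unfolding killing_S_nth(4) by (rule d_uminus[OF killing_S_smooth])
  have ephi: "map_matrix euler (phi N S q v) = mat22 (euler x) (euler y) (euler z) (- euler x)"
    by (intro eq22I) (simp_all add: phi euler_uminus)
  have "killing_S q = reduced_S a b c ?w"
    by (simp add: killing_S_def a_def b_def c_def)
  moreover have "dmat v killing_S = mat22 (dfls v (\<lambda>q. killing_S q $ 1 $ 1)) (dfls v (\<lambda>q. killing_S q $ 1 $ 2))
      (dfls v (\<lambda>q. killing_S q $ 2 $ 1)) (- dfls v (\<lambda>q. killing_S q $ 1 $ 1))"
    by (intro eq22I) (simp_all add: dmat_def F22)
  \<comment> \<open>The differentials inside \<open>euler\<close> are rewritten first, so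
    \<open>eda\<close>, \<open>edb\<close>, \<open>edc\<close> and \<open>edu\<close> enter with
    their left-hand sides already expanded.\<close>
  ultimately have "dmat v killing_S + comm (phi N S q v) (killing_S q) =
      mat22 (euler x) (euler y) (euler z) (- euler x)"
    unfolding phi
    by (simp only: alg[symmetric] reduced_S_def F11 F12 F21 eda[unfolded da] edb[unfolded db]
        edc[unfolded dc] edu[unfolded du] da db dc du dm inv
        quarter times_divide_eq_left times_divide_eq_right mult_1_left mult_1_right)
  then show ?thesis
    by (simp only: ephi)
qed

lemma killing_S_spectral:
  assumes "\<And>q. (r q)\<^sup>2 = bold_b S q * bold_c S q"
  shows "spectral_killing_field \<A> N S (spectral_S N \<gamma> sg S r p)"
  unfolding spectral_killing_field_def
proof (intro exI conjI allI ballI)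
  show "g_valued \<A> killing_S"
    unfolding g_valued_def by (simp add: killing_S_twisted killing_S_smooth)
  show "spectral_S N \<gamma> sg S r p q = map_matrix lift (killing_S q)" for q
    using spectral_S_reduced[where N = N and p = p and S = S and r = r and q = q,
        OF \<gamma> sg assms bold_nonzero(2,3) quadric]
    by (simp only: killing_S_def potential_def divide_inverse)
  show "dmat v killing_S + comm (phi N S q v) (killing_S q) = map_matrix euler (phi N S q v)"
    if "v \<in> tangent_space \<A> q" for q v
    by (rule killing_S_equation[OF that])
qed

end

theorem proposition5p4:
  fixes \<A> :: "('m::{t2_space, second_countable_topology}, 'e::euclidean_space) atlas"
    and N :: nat
    and \<gamma> sg :: complex
    and S :: "'m cmc_data"
    and r :: "'m \<Rightarrow> complex fls"
    and p :: "'m \<Rightarrow> complex fps"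
  assumes "\<gamma> \<noteq> 0" and "cnj \<gamma> = \<gamma>" and "sg\<^sup>2 = \<gamma>"
    and "truncated_cmc_solution \<A> N \<gamma> S"
    and "smooth_fls \<A> r" and "\<And>q. (r q)\<^sup>2 = bold_b S q * bold_c S q"
    and "smooth_fls \<A> (\<lambda>q. fps_to_fls (p q))" and "\<And>q k. odd k \<Longrightarrow> fps_nth (p q) k = 0"
    and "\<And>q v. v \<in> tangent_space \<A> q \<Longrightarrow>
           dfls v (\<lambda>x. fps_to_fls (p x)) =
             cst sg * (bold_b S q * phi_check N S q v $ 1 $ 2
                       + bold_c S q * phi_check N S q v $ 2 $ 1)
               / (bold_b S q * bold_c S q)"
  shows "spectral_killing_field \<A> N S (spectral_S N \<gamma> sg S r p)"
  using killing_S_spectral[OF assms(1,3,4,7,8,9), of r] assms(6) by blast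

end
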